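(* Let $R$ be a commutative ring and let $\mathfrak F$ be the family of functors of $\mathcal R$-modules defined in the context. If $\mathbb M\in\mathfrak F$, then $\mathbb M$ is D-proquasi-coherent.
   Context: $R$ is a commutative ring with unit. All functors are covariant functors on the category of commutative $R$-algebras. $\mathcal R$ is the functor of rings $\mathcal R(S)=S$. A functor of $\mathcal R$-modules $\mathbb M$ is a functor of sets with morphisms of functors $\mathbb M\times\mathbb M\to\mathbb M$, $\mathcal R\times\mathbb M\to\mathbb M$ making $\mathbb M(S)$ an $S$-module for every commutative $R$-algebra $S$. Morphisms are natural transformations $f$ with every $f_S$ $S$-linear; $f$ is injective if every $f_S$ is. $\mathbb M^*(S):=\operatorname{Hom}_{\mathcal S}(\mathbb M_{|S},\mathcal S)$, where $\mathbb M_{|S}$ is the restriction to commutative $S$-algebras and $\mathcal S(T)=T$. A dual functor of $\mathcal R$-modules is one of the form $\mathbb N^*$ (up to isomorphism) for a functor of $\mathcal R$-modules $\mathbb N$ (only functors for which the Hom's involved are sets are considered). $\mathbb M(\mathcal R)$ denotes the functor $S\mapsto\mathbb M(R)\otimes_R S$, with natural morphism $\mathbb M(\mathcal R)\to\mathbb M$, $m\otimes s\mapsto s\cdot m$. $\mathbb M$ is D-proquasi-coherent if the dual morphism $\mathbb M^*\to\mathbb M(\mathcal R)^*$ is injective. For a set $J$, $\bigoplus_J\mathcal R$ and $\prod_J\mathcal R$ are the functors $S\mapsto\bigoplus_J S$, $S\mapsto\prod_J S$; $\prod_J\mathcal R$ is a functor of $\mathcal R$-algebras with componentwise multiplication, and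 $\bigoplus_J\mathcal R$, $\prod_J\mathcal R$ are functors of $\prod_J\mathcal R$-modules. Definition of $\mathfrak F$: it is the family of dual functors of $\mathcal R$-modules $\mathbb M$ such that there exist a set $J$ (depending on $\mathbb M$), a structure of functor of $\prod_J\mathcal R$-modules on $\mathbb M$ (extending its $\mathcal R$-module structure) and inclusions of functors of $\prod_J\mathcal R$-modules $\bigoplus_J\mathcal R\subseteq\mathbb M\subseteq\prod_J\mathcal R$ whose composite $\bigoplus_J\mathcal R\subseteq\prod_J\mathcal R$ is the obvious inclusion. *)

theory Defs
  imports "HOL-Algebra.Module" "HOL-Algebra.Generated_Groups" "HOL-Algebra.Free_Abelian_Groups"
begin

section \<open>Commutative algebras and scalar restriction\<close>

text \<open>
  The type \<open>'u\<close> is the universe: the small rings and the small sets are those whose underlying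
  set is a subset of \<open>'u\<close>, and functors are defined on the category of small commutative algebras.
  Functors take values in modules over an arbitrary type. If \<open>'u\<close> is infinite, then the category
  is closed, up to isomorphism, under polynomial algebras in a small set of variables; over a
  finite \<open>'u\<close> it would contain too few algebras to test naturality.

  The scalar multiplication of an algebra is normalised to be \<^const>\<open>undefined\<close> outside
  the carriers, and morphisms are extensional. Each algebra is isomorphic to a normalised one, and
  normalisation makes restriction of scalars strictly functorial: restricting along a composite,
  or restricting the \<open>S\<close>-algebra \<open>S\<close> to \<open>R\<close>, gives equal (not just isomorphic) algebras.
\<close>

definition algebras :: "('u, 'z) ring_scheme \<Rightarrow> ('u, 'u) module set" where
  "algebras R = {S. algebra R S \<and>
     (\<forall>r x. \<not> (r \<in> carrier R \<and> x \<in> carrier S) \<longrightarrow> r \<odot>\<^bsub>S\<^esub> x = undefined)}"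

definition algebra_hom ::
    "('u, 'z) ring_scheme \<Rightarrow> ('u, 'u) module \<Rightarrow> ('u, 'u) module \<Rightarrow> ('u \<Rightarrow> 'u) set" where
  "algebra_hom R S T = {f \<in> ring_hom S T. f \<in> extensional (carrier S) \<and>
     (\<forall>r\<in>carrier R. \<forall>x\<in>carrier S. f (r \<odot>\<^bsub>S\<^esub> x) = r \<odot>\<^bsub>T\<^esub> f x)}"

definition structure_map :: "('u, 'z) ring_scheme \<Rightarrow> ('u, 'u) module \<Rightarrow> 'u \<Rightarrow> 'u" where
  "structure_map R S = (\<lambda>r\<in>carrier R. r \<odot>\<^bsub>S\<^esub> \<one>\<^bsub>S\<^esub>)"

definition self_algebra :: "('a, 'z) ring_scheme \<Rightarrow> ('a, 'a) module" where
  "self_algebra S = \<lparr>carrier = carrier S, monoid.mult = monoid.mult S, one = one S,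
     ring.zero = ring.zero S, ring.add = ring.add S,
     smult = (\<lambda>a x. if a \<in> carrier S \<and> x \<in> carrier S then a \<otimes>\<^bsub>S\<^esub> x else undefined)\<rparr>"

definition restrict_scalars ::
    "('u, 'z) ring_scheme \<Rightarrow> ('u \<Rightarrow> 'u) \<Rightarrow> ('u, 'u) module \<Rightarrow> ('u, 'u) module" where
  "restrict_scalars R f T = T\<lparr>smult :=
     (\<lambda>r x. if r \<in> carrier R \<and> x \<in> carrier T then f r \<odot>\<^bsub>T\<^esub> x else undefined)\<rparr>"


section \<open>Functors of modules\<close>

text \<open>
  The same record type represents functors of algebras and functors of modules over them: for a
  functor of algebras \<open>A\<close> the ring structure of \<open>fobj A S\<close> is used, and a
  functor of \<open>A\<close>-modules \<open>M\<close> has scalars \<open>'k\<close> in the carrier of \<open>fobj A S\<close>. The ring fields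
  \<^const>\<open>monoid.mult\<close> and \<^const>\<open>one\<close> of a value \<open>fobj M S\<close> are irrelevant when \<open>M\<close> is just a
  functor of modules.
\<close>

record ('u, 'k, 'b) mod_functor =
  fobj :: "('u, 'u) module \<Rightarrow> ('k, 'b) module"
  fmap :: "('u, 'u) module \<Rightarrow> ('u, 'u) module \<Rightarrow> ('u \<Rightarrow> 'u) \<Rightarrow> 'b \<Rightarrow> 'b"

text \<open>
  \<open>fmap_add\<close> and \<open>fmap_smult\<close> express that addition \<open>M \<times> M \<rightarrow> M\<close> and scalar multiplication
  \<open>A \<times> M \<rightarrow> M\<close> are morphisms of functors.
\<close>

locale module_functor =
  fixes R :: "('u, 'z) ring_scheme"
    and A :: "('u, 'c, 'k) mod_functor"
    and M :: "('u, 'k, 'b) mod_functor"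
  assumes fobj_module: "S \<in> algebras R \<Longrightarrow> module (fobj A S) (fobj M S)"
    and fmap_closed: "\<lbrakk>S \<in> algebras R; T \<in> algebras R; f \<in> algebra_hom R S T;
      x \<in> carrier (fobj M S)\<rbrakk> \<Longrightarrow> fmap M S T f x \<in> carrier (fobj M T)"
    and fmap_id: "\<lbrakk>S \<in> algebras R; x \<in> carrier (fobj M S)\<rbrakk> \<Longrightarrow>
      fmap M S S (\<lambda>s\<in>carrier S. s) x = x"
    and fmap_comp: "\<lbrakk>S \<in> algebras R; T \<in> algebras R; U \<in> algebras R;
      f \<in> algebra_hom R S T; g \<in> algebra_hom R T U; x \<in> carrier (fobj M S)\<rbrakk> \<Longrightarrow>
      fmap M S U (compose (carrier S) g f) x = fmap M T U g (fmap M S T f x)"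
    and fmap_add: "\<lbrakk>S \<in> algebras R; T \<in> algebras R; f \<in> algebra_hom R S T;
      x \<in> carrier (fobj M S); y \<in> carrier (fobj M S)\<rbrakk> \<Longrightarrow>
      fmap M S T f (x \<oplus>\<^bsub>fobj M S\<^esub> y) = fmap M S T f x \<oplus>\<^bsub>fobj M T\<^esub> fmap M S T f y"
    and fmap_smult: "\<lbrakk>S \<in> algebras R; T \<in> algebras R; f \<in> algebra_hom R S T;
      a \<in> carrier (fobj A S); x \<in> carrier (fobj M S)\<rbrakk> \<Longrightarrow>
      fmap M S T f (a \<odot>\<^bsub>fobj M S\<^esub> x) = fmap A S T f a \<odot>\<^bsub>fobj M T\<^esub> fmap M S T f x"

text \<open>Morphisms are extensional, so that equality of morphisms is equality in HOL.\<close>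

definition functor_hom ::
    "('u, 'z) ring_scheme \<Rightarrow> ('u, 'c, 'k) mod_functor \<Rightarrow> ('u, 'k, 'm) mod_functor
      \<Rightarrow> ('u, 'k, 'n) mod_functor \<Rightarrow> (('u, 'u) module \<Rightarrow> 'm \<Rightarrow> 'n) set" where
  "functor_hom R A M N =
    {h \<in> (\<Pi>\<^sub>E S\<in>algebras R. carrier (fobj M S) \<rightarrow>\<^sub>E carrier (fobj N S)).
      (\<forall>S\<in>algebras R. \<forall>x\<in>carrier (fobj M S). \<forall>y\<in>carrier (fobj M S).
        h S (x \<oplus>\<^bsub>fobj M S\<^esub> y) = h S x \<oplus>\<^bsub>fobj N S\<^esub> h S y) \<and>
      (\<forall>S\<in>algebras R. \<forall>a\<in>carrier (fobj A S). \<forall>x\<in>carrier (fobj M S).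
        h S (a \<odot>\<^bsub>fobj M S\<^esub> x) = a \<odot>\<^bsub>fobj N S\<^esub> h S x) \<and>
      (\<forall>S\<in>algebras R. \<forall>T\<in>algebras R. \<forall>f\<in>algebra_hom R S T. \<forall>x\<in>carrier (fobj M S).
        h T (fmap M S T f x) = fmap N S T f (h S x))}"

definition injective_hom ::
    "('u, 'z) ring_scheme \<Rightarrow> ('u, 'k, 'm) mod_functor
      \<Rightarrow> (('u, 'u) module \<Rightarrow> 'm \<Rightarrow> 'n) \<Rightarrow> bool" where
  "injective_hom R M h \<longleftrightarrow> (\<forall>S\<in>algebras R. inj_on (h S) (carrier (fobj M S)))"

definition isomorphic_functors ::
    "('u, 'z) ring_scheme \<Rightarrow> ('u, 'c, 'k) mod_functor \<Rightarrow> ('u, 'k, 'm) mod_functor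
      \<Rightarrow> ('u, 'k, 'n) mod_functor \<Rightarrow> bool" where
  "isomorphic_functors R A M N \<longleftrightarrow>
    (\<exists>h\<in>functor_hom R A M N. \<exists>k\<in>functor_hom R A N M. \<forall>S\<in>algebras R.
      (\<forall>x\<in>carrier (fobj M S). k S (h S x) = x) \<and> (\<forall>y\<in>carrier (fobj N S). h S (k S y) = y))"

text \<open>
  The functor \<open>S \<mapsto> S\<close>. It does not mention the base ring, so it serves as the structure functor
  over \<open>R\<close> and over each \<open>R\<close>-algebra.
\<close>

definition scalar_functor :: "('u, 'u, 'u) mod_functor" where
  "scalar_functor = \<lparr>fobj = self_algebra, fmap = (\<lambda>S T f. f)\<rparr>"


section \<open>Dual functors\<close>

definition restrict_functor ::
    "('u, 'z) ring_scheme \<Rightarrow> ('u, 'u) module \<Rightarrow> ('u, 'k, 'm) mod_functor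
      \<Rightarrow> ('u, 'k, 'm) mod_functor" where
  "restrict_functor R S M =
    \<lparr>fobj = (\<lambda>T. fobj M (restrict_scalars R (structure_map R S) T)),
     fmap = (\<lambda>T U. fmap M (restrict_scalars R (structure_map R S) T)
                          (restrict_scalars R (structure_map R S) U))\<rparr>"

definition dual_functor ::
    "('u, 'z) ring_scheme \<Rightarrow> ('u, 'u, 'm) mod_functor
      \<Rightarrow> ('u, 'u, ('u, 'u) module \<Rightarrow> 'm \<Rightarrow> 'u) mod_functor" where
  "dual_functor R M =
    \<lparr>fobj = (\<lambda>S.
       \<lparr>carrier = functor_hom S scalar_functor (restrict_functor R S M) scalar_functor,
        monoid.mult = undefined, one = undefined,
        ring.zero = (\<lambda>T\<in>algebras S. \<lambda>x\<in>carrier (fobj (restrict_functor R S M) T). \<zero>\<^bsub>T\<^esub>),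
        ring.add = (\<lambda>w v. \<lambda>T\<in>algebras S. \<lambda>x\<in>carrier (fobj (restrict_functor R S M) T).
                 w T x \<oplus>\<^bsub>T\<^esub> v T x),
        smult = (\<lambda>s w. \<lambda>T\<in>algebras S. \<lambda>x\<in>carrier (fobj (restrict_functor R S M) T).
                 s \<odot>\<^bsub>T\<^esub> w T x)\<rparr>),
     fmap = (\<lambda>S S' f w. \<lambda>T\<in>algebras S'. w (restrict_scalars S f T))\<rparr>"

text \<open>For \<open>h : M \<rightarrow> N\<close> this is \<open>h\<^sup>* : N\<^sup>* \<rightarrow> M\<^sup>*\<close>.\<close>

definition dual_hom ::
    "('u, 'z) ring_scheme \<Rightarrow> ('u, 'u, 'm) mod_functor \<Rightarrow> ('u, 'u, 'n) mod_functor
      \<Rightarrow> (('u, 'u) module \<Rightarrow> 'm \<Rightarrow> 'n)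
      \<Rightarrow> ('u, 'u) module \<Rightarrow> (('u, 'u) module \<Rightarrow> 'n \<Rightarrow> 'u) \<Rightarrow> (('u, 'u) module \<Rightarrow> 'm \<Rightarrow> 'u)" where
  "dual_hom R M N h =
    (\<lambda>S\<in>algebras R. \<lambda>w\<in>carrier (fobj (dual_functor R N) S).
      \<lambda>T\<in>algebras S. \<lambda>x\<in>carrier (fobj (restrict_functor R S M) T).
        w T (h (restrict_scalars R (structure_map R S) T) x))"

text \<open>
  The type argument is the value type of the functor being dualised, over which HOL cannot
  quantify existentially. A hypothesis \<open>is_dual_functor TYPE('n) R M\<close> of a theorem
  polymorphic in \<open>'n\<close> thus says that \<open>M\<close> is a dual functor, without any size restriction.
\<close>

definition is_dual_functor ::
    "'n itself \<Rightarrow> ('u, 'z) ring_scheme \<Rightarrow> ('u, 'u, 'm) mod_functor \<Rightarrow> bool" where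
  "is_dual_functor _ R M \<longleftrightarrow>
    (\<exists>N :: ('u, 'u, 'n) mod_functor. module_functor R scalar_functor N \<and>
      isomorphic_functors R scalar_functor M (dual_functor R N))"


section \<open>The functor \<open>S \<mapsto> M(R) \<otimes>\<^sub>R S\<close>\<close>

text \<open>
  \<open>E \<otimes>\<^sub>R S\<close> is the free abelian group on \<open>E \<times> S\<close> modulo the subgroup generated by the usual
  bilinearity relations; its elements are cosets.
\<close>

definition tensor_relations ::
    "('u, 'z) ring_scheme \<Rightarrow> ('u, 'e) module \<Rightarrow> ('u, 'u) module \<Rightarrow> (('e \<times> 'u) \<Rightarrow>\<^sub>0 int) set" where
  "tensor_relations R E S =
    {frag_of (x \<oplus>\<^bsub>E\<^esub> y, s) - frag_of (x, s) - frag_of (y, s) | x y s.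
        x \<in> carrier E \<and> y \<in> carrier E \<and> s \<in> carrier S} \<union>
    {frag_of (x, s \<oplus>\<^bsub>S\<^esub> t) - frag_of (x, s) - frag_of (x, t) | x s t.
        x \<in> carrier E \<and> s \<in> carrier S \<and> t \<in> carrier S} \<union>
    {frag_of (r \<odot>\<^bsub>E\<^esub> x, s) - frag_of (x, r \<odot>\<^bsub>S\<^esub> s) | r x s.
        r \<in> carrier R \<and> x \<in> carrier E \<and> s \<in> carrier S}"

abbreviation free_tensor ::
    "('u, 'e) module \<Rightarrow> ('u, 'u) module \<Rightarrow> (('e \<times> 'u) \<Rightarrow>\<^sub>0 int) monoid" where
  "free_tensor E S \<equiv> free_Abelian_group (carrier E \<times> carrier S)"

definition tensor_kernel ::
    "('u, 'z) ring_scheme \<Rightarrow> ('u, 'e) module \<Rightarrow> ('u, 'u) module \<Rightarrow> (('e \<times> 'u) \<Rightarrow>\<^sub>0 int) set" where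
  "tensor_kernel R E S = generate (free_tensor E S) (tensor_relations R E S)"

text \<open>
  The additive map \<open>E \<otimes>\<^sub>R S \<rightarrow> E \<otimes>\<^sub>R T\<close>, \<open>x \<otimes> s \<mapsto> x \<otimes> f s\<close>. It sends the coset of \<open>c\<close> to the
  coset of the image of \<open>c\<close>, which is the sumset of the kernel and the image of the
  coset.
\<close>

definition tensor_map ::
    "('u, 'z) ring_scheme \<Rightarrow> ('u, 'e) module \<Rightarrow> ('u, 'u) module \<Rightarrow> ('u \<Rightarrow> 'u)
      \<Rightarrow> (('e \<times> 'u) \<Rightarrow>\<^sub>0 int) set \<Rightarrow> (('e \<times> 'u) \<Rightarrow>\<^sub>0 int) set" where
  "tensor_map R E T f X = set_mult (free_tensor E T) (tensor_kernel R E T)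
     (frag_extend (\<lambda>(x, s). frag_of (x, f s)) ` X)"

definition base_change ::
    "('u, 'z) ring_scheme \<Rightarrow> ('u, 'e) module \<Rightarrow> ('u, 'u) module
      \<Rightarrow> ('u, (('e \<times> 'u) \<Rightarrow>\<^sub>0 int) set) module" where
  "base_change R E S = (let G = free_tensor E S Mod tensor_kernel R E S in
    \<lparr>carrier = carrier G, monoid.mult = undefined, one = undefined,
     ring.zero = \<one>\<^bsub>G\<^esub>, ring.add = monoid.mult G,
     smult = (\<lambda>s. tensor_map R E S (\<lambda>t. s \<otimes>\<^bsub>S\<^esub> t))\<rparr>)"

definition quasi_coherent_functor ::
    "('u, 'z) ring_scheme \<Rightarrow> ('u, 'e) module
      \<Rightarrow> ('u, 'u, (('e \<times> 'u) \<Rightarrow>\<^sub>0 int) set) mod_functor" where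
  "quasi_coherent_functor R E =
    \<lparr>fobj = base_change R E, fmap = (\<lambda>S T f. tensor_map R E T f)\<rparr>"

definition global_sections ::
    "('u, 'z) ring_scheme \<Rightarrow> ('u, 'u, 'm) mod_functor \<Rightarrow> ('u, 'm) module" where
  "global_sections R M = fobj M (self_algebra R)"

text \<open>
  The morphism \<open>M(R) \<otimes>\<^sub>R S \<rightarrow> M(S)\<close>, \<open>m \<otimes> s \<mapsto> s \<cdot> m\<close>: the additive extension of
  \<open>(m, s) \<mapsto> s \<cdot> m\<close> to the free abelian group is constant on each coset, and its value there is
  taken with \<^const>\<open>the_elem\<close>.
\<close>

definition natural_hom ::
    "('u, 'z) ring_scheme \<Rightarrow> ('u, 'u, 'm) mod_functor
      \<Rightarrow> ('u, 'u) module \<Rightarrow> (('m \<times> 'u) \<Rightarrow>\<^sub>0 int) set \<Rightarrow> 'm" where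
  "natural_hom R M =
    (\<lambda>S\<in>algebras R. \<lambda>X\<in>carrier (base_change R (global_sections R M) S).
      the_elem ((\<lambda>c. finsum (fobj M S)
          (\<lambda>p. [Poly_Mapping.lookup c p] \<cdot>\<^bsub>fobj M S\<^esub>
             (snd p \<odot>\<^bsub>fobj M S\<^esub> fmap M (self_algebra R) S (structure_map R S) (fst p)))
          (Poly_Mapping.keys c)) ` X))"

definition D_proquasi_coherent ::
    "('u, 'z) ring_scheme \<Rightarrow> ('u, 'u, 'm) mod_functor \<Rightarrow> bool" where
  "D_proquasi_coherent R M \<longleftrightarrow>
    injective_hom R (dual_functor R M)
      (dual_hom R (quasi_coherent_functor R (global_sections R M)) M (natural_hom R M))"


section \<open>The family F\<close>

definition product_algebra :: "'j set \<Rightarrow> ('u, 'u) module \<Rightarrow> ('u, 'j \<Rightarrow> 'u) module" where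
  "product_algebra J S =
    \<lparr>carrier = J \<rightarrow>\<^sub>E carrier S,
     monoid.mult = (\<lambda>a b. \<lambda>j\<in>J. a j \<otimes>\<^bsub>S\<^esub> b j), one = (\<lambda>j\<in>J. \<one>\<^bsub>S\<^esub>),
     ring.zero = (\<lambda>j\<in>J. \<zero>\<^bsub>S\<^esub>), ring.add = (\<lambda>a b. \<lambda>j\<in>J. a j \<oplus>\<^bsub>S\<^esub> b j),
     smult = (\<lambda>s a. \<lambda>j\<in>J. s \<otimes>\<^bsub>S\<^esub> a j)\<rparr>"

definition product_functor :: "'j set \<Rightarrow> ('u, 'u, 'j \<Rightarrow> 'u) mod_functor" where
  "product_functor J =
    \<lparr>fobj = product_algebra J, fmap = (\<lambda>S T f a. \<lambda>j\<in>J. f (a j))\<rparr>"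

text \<open>The product and the direct sum as functors of modules over the product.\<close>

definition product_module_functor :: "'j set \<Rightarrow> ('u, 'j \<Rightarrow> 'u, 'j \<Rightarrow> 'u) mod_functor" where
  "product_module_functor J =
    \<lparr>fobj = (\<lambda>S. self_algebra (product_algebra J S)), fmap = fmap (product_functor J)\<rparr>"

definition sum_module_functor :: "'j set \<Rightarrow> ('u, 'j \<Rightarrow> 'u, 'j \<Rightarrow> 'u) mod_functor" where
  "sum_module_functor J =
    \<lparr>fobj = (\<lambda>S. self_algebra (product_algebra J S)
        \<lparr>carrier := {a \<in> J \<rightarrow>\<^sub>E carrier S. finite {j \<in> J. a j \<noteq> \<zero>\<^bsub>S\<^esub>}}\<rparr>),
     fmap = fmap (product_functor J)\<rparr>"

definition with_action ::
    "('u, 'k, 'm) mod_functor \<Rightarrow> (('u, 'u) module \<Rightarrow> 'l \<Rightarrow> 'm \<Rightarrow> 'm)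
      \<Rightarrow> ('u, 'l, 'm) mod_functor" where
  "with_action M act =
    \<lparr>fobj = (\<lambda>S. \<lparr>carrier = carrier (fobj M S), monoid.mult = monoid.mult (fobj M S),
        one = one (fobj M S),
        ring.zero = ring.zero (fobj M S), ring.add = ring.add (fobj M S), smult = act S\<rparr>),
     fmap = fmap M\<rparr>"

text \<open>
  The index set \<open>J\<close> ranges over the small sets. The equation \<open>act S (\<lambda>j\<in>J. s) x = s \<cdot> x\<close> says that
  the action of the product extends the given module structure along the diagonal.
\<close>

definition family_F ::
    "'n itself \<Rightarrow> ('u, 'z) ring_scheme \<Rightarrow> ('u, 'u, 'm) mod_functor \<Rightarrow> bool" where
  "family_F n R M \<longleftrightarrow>
    module_functor R scalar_functor M \<and> is_dual_functor n R M \<and>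
    (\<exists>(J :: 'u set) act.
      module_functor R (product_functor J) (with_action M act) \<and>
      (\<forall>S\<in>algebras R. \<forall>s\<in>carrier S. \<forall>x\<in>carrier (fobj M S).
        act S (\<lambda>j\<in>J. s) x = s \<odot>\<^bsub>fobj M S\<^esub> x) \<and>
      (\<exists>i\<in>functor_hom R (product_functor J) (sum_module_functor J) (with_action M act).
       \<exists>p\<in>functor_hom R (product_functor J) (with_action M act) (product_module_functor J).
        injective_hom R (sum_module_functor J) i \<and>
        injective_hom R (with_action M act) p \<and>
        (\<forall>S\<in>algebras R. \<forall>a\<in>carrier (fobj (sum_module_functor J) S). p S (i S a) = a)))"

end

theory Submission
  imports Defs "HOL-Algebra.Generated_Rings" "HOL-Algebra.Weak_Morphisms"
begin

text \<open>
  Let \<open>S\<close> be an \<open>R\<close>-algebra and let \<open>w\<close>, \<open>v\<close> be functionals on \<open>M\<close> over \<open>S\<close> that have the same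
  restriction to \<open>M(R) \<otimes> T\<close> for every \<open>S\<close>-algebra \<open>T\<close>. To see that they agree at \<open>m \<in> M(T)\<close>, use
  the action of the product and consider the functions \<open>a \<mapsto> w(a \<cdot> m)\<close> and \<open>a \<mapsto> v(a \<cdot> m)\<close> on
  \<open>T\<^sup>J\<close>. They are polynomial functions: by naturality, their value at \<open>a\<close> is obtained by substituting
  \<open>a\<close> into their value at the generic point of \<open>T[x\<^sub>j | j \<in> J]\<close>
  (\<open>functional_depends_on_finitely_many_coordinates\<close>). A polynomial involves only a finite set \<open>F\<close>
  of variables, so replacing the constant family \<open>1\<close> by the indicator \<open>1\<^sub>F\<close> of \<open>F\<close> does not
  change the value:
  \<open>w(m) = w(1 \<cdot> m) = w(1\<^sub>F \<cdot> m)\<close>, and similarly for \<open>v\<close> with the same, large enough, \<open>F\<close>.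

  Inside the product, \<open>1\<^sub>F \<cdot> m\<close> has finite support, so by injectivity of \<open>M \<rightarrow> \<Prod>\<^sub>J R\<close> it comes from the
  direct sum (\<open>act_indicator\<close>). There it is a finite sum of multiples \<open>t \<cdot> e\<^sub>j\<close> of basis vectors. The
  \<open>e\<^sub>j\<close> are defined over \<open>R\<close>, hence \<open>t \<cdot> e\<^sub>j\<close> is the image of \<open>e\<^sub>j \<otimes> t \<in> M(R) \<otimes> T\<close>
  (\<open>natural_hom_elementary_tensor\<close>), where \<open>w\<close> and \<open>v\<close> agree by assumption
  (\<open>functionals_agree_on_sum\<close>).

  The algebra that carries the generic point has to be small. It is realised as a ring of
  polynomial functions (\<open>generic_point\<close>), and its elements are coded in the universe through the
  ring terms that denote them; this is where the universe must be infinite.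
\<close>

section \<open>Cardinality of generated rings\<close>

text \<open>
  The size of a generated ring is bounded by counting the terms that denote its elements.
\<close>
datatype 'a ring_term =
  Gen 'a | Unit | Neg "'a ring_term" | Plus "'a ring_term" "'a ring_term"
  | Times "'a ring_term" "'a ring_term"

primrec eval_term :: "('b, 'z) ring_scheme \<Rightarrow> ('a \<Rightarrow> 'b) \<Rightarrow> 'a ring_term \<Rightarrow> 'b" where
  "eval_term P g (Gen u) = g u"
| "eval_term P g Unit = \<one>\<^bsub>P\<^esub>"
| "eval_term P g (Neg a) = \<ominus>\<^bsub>P\<^esub> eval_term P g a"
| "eval_term P g (Plus a b) = eval_term P g a \<oplus>\<^bsub>P\<^esub> eval_term P g b"
| "eval_term P g (Times a b) = eval_term P g a \<otimes>\<^bsub>P\<^esub> eval_term P g b"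

text \<open>
  A node becomes the list of the codes of its arguments. The five constructors are told apart by
  the length of the list, which is why the last argument is repeated; a single injection
  \<open>c\<close> of lists into \<open>'a\<close> then codes all terms.
\<close>
primrec encode_term :: "('a list \<Rightarrow> 'a) \<Rightarrow> 'a ring_term \<Rightarrow> 'a" where
  "encode_term c (Gen u) = c [u]"
| "encode_term c Unit = c []"
| "encode_term c (Neg a) = c [encode_term c a, encode_term c a]"
| "encode_term c (Plus a b) = c [encode_term c a, encode_term c b, encode_term c b]"
| "encode_term c (Times a b) =
     c [encode_term c a, encode_term c b, encode_term c b, encode_term c b]"

lemma inj_encode_term:
  assumes "inj c"
  shows "inj (encode_term c)"
proof -
  have c: "c xs = c ys \<longleftrightarrow> xs = ys" for xs ys
    using assms by (auto dest: injD)
  have "encode_term c s = encode_term c t \<Longrightarrow> s = t" for s t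
  proof (induction s arbitrary: t)
    case (Gen u) then show ?case by (cases t) (auto simp: c)
  next
    case Unit then show ?case by (cases t) (auto simp: c)
  next
    case (Neg a) then show ?case by (cases t) (auto simp: c)
  next
    case (Plus a b) then show ?case by (cases t) (auto simp: c)
  next
    case (Times a b) then show ?case by (cases t) (auto simp: c)
  qed
  then show ?thesis by (auto intro: injI)
qed

text \<open>
  Over an infinite universe, a ring generated by a small set is small: its elements are values of
  ring terms over the universe, and these can be coded in the universe.
\<close>
lemma ex_inj_on_generate_ring:
  assumes "infinite (UNIV :: 'u set)" and "|H| \<le>o |UNIV :: 'u set|"
  shows "\<exists>f :: 'b \<Rightarrow> 'u. inj_on f (generate_ring P H)"
proof -
  obtain h :: "'b \<Rightarrow> 'u" where "inj_on h H"
    using assms(2) by (auto simp flip: card_of_ordLeq)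
  define g where "g = inv_into H h"
  have g: "\<exists>u. g u = x" if "x \<in> H" for x
    using that \<open>inj_on h H\<close> by (auto simp: g_def intro: exI[of _ "h x"])
  have "|lists (UNIV :: 'u set)| =o |UNIV :: 'u set|"
    using assms(1) by (rule card_of_lists_infinite)
  then obtain c :: "'u list \<Rightarrow> 'u" where "bij_betw c (lists UNIV) UNIV"
    using card_of_ordIso by blast
  then have inj: "inj (encode_term c)"
    by (auto simp: bij_betw_def intro: inj_encode_term)
  have "\<exists>t. eval_term P g t = x" if "x \<in> generate_ring P H" for x
    using that
  proof (induction rule: generate_ring.induct)
    case (incl h)
    then show ?case
      using g by (metis eval_term.simps(1))
  qed (metis eval_term.simps)+
  then have "inj_on (inv_into UNIV (eval_term P g)) (generate_ring P H)"
    by (intro inj_on_inv_into[where f = "eval_term P g"]) (auto simp: image_def)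
  then have "inj_on (encode_term c \<circ> inv_into UNIV (eval_term P g)) (generate_ring P H)"
    by (rule comp_inj_on) (rule inj_on_subset[OF inj subset_UNIV])
  then show ?thesis
    by blast
qed

section \<open>An algebra with a generic point\<close>

lemma cring_product_algebra:
  assumes "cring T"
  shows "cring (product_algebra D T)"
proof -
  interpret T: cring T by fact
  show ?thesis
  proof (rule cringI)
    show "abelian_group (product_algebra D T)"
    proof (rule abelian_groupI)
      fix x assume "x \<in> carrier (product_algebra D T)"
      then show "\<exists>y\<in>carrier (product_algebra D T). y \<oplus>\<^bsub>product_algebra D T\<^esub> x = \<zero>\<^bsub>product_algebra D T\<^esub>"
        by (intro bexI[of _ "\<lambda>j\<in>D. \<ominus>\<^bsub>T\<^esub> x j"])
          (auto simp: product_algebra_def PiE_iff fun_eq_iff T.l_neg)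
    qed (auto simp: product_algebra_def PiE_iff fun_eq_iff T.a_ac extensional_def
        intro!: T.r_zero T.l_zero)
    show "comm_monoid (product_algebra D T)"
      by (rule comm_monoidI)
        (auto simp: product_algebra_def PiE_iff fun_eq_iff T.m_ac extensional_def)
  qed (auto simp: product_algebra_def PiE_iff fun_eq_iff T.l_distr)
qed

lemma ring_hom_structure_map:
  assumes "algebra S T"
  shows "structure_map S T \<in> ring_hom S T"
proof -
  interpret algebra S T by fact
  show ?thesis
    by (rule ring_hom_memI)
      (auto simp: structure_map_def smult_l_distr smult_assoc2 smult_assoc1)
qed

text \<open>
  An \<open>S\<close>-algebra is a ring homomorphism out of \<open>S\<close>; the scalar multiplication is cut off outside
  the carriers, as membership in \<^const>\<open>algebras\<close> requires.
\<close>
definition algebra_of_hom :: "('u, 'z) ring_scheme \<Rightarrow> 'u ring \<Rightarrow> ('u \<Rightarrow> 'u) \<Rightarrow> ('u, 'u) module" where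
  "algebra_of_hom S Q \<phi> = ring.extend Q
    \<lparr>smult = (\<lambda>r x. if r \<in> carrier S \<and> x \<in> carrier Q then \<phi> r \<otimes>\<^bsub>Q\<^esub> x else undefined)\<rparr>"

lemma algebra_of_hom_simps [simp]:
  "carrier (algebra_of_hom S Q \<phi>) = carrier Q"
  "monoid.mult (algebra_of_hom S Q \<phi>) = monoid.mult Q"
  "one (algebra_of_hom S Q \<phi>) = one Q"
  "ring.zero (algebra_of_hom S Q \<phi>) = ring.zero Q"
  "ring.add (algebra_of_hom S Q \<phi>) = ring.add Q"
  "r \<odot>\<^bsub>algebra_of_hom S Q \<phi>\<^esub> x =
    (if r \<in> carrier S \<and> x \<in> carrier Q then \<phi> r \<otimes>\<^bsub>Q\<^esub> x else undefined)"
  by (simp_all add: algebra_of_hom_def ring.defs)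

lemma algebra_of_hom_in_algebras:
  assumes "cring S" "cring Q" "\<phi> \<in> ring_hom S Q"
  shows "algebra_of_hom S Q \<phi> \<in> algebras S"
proof -
  interpret S: cring S by fact
  interpret Q: cring Q by fact
  let ?U = "algebra_of_hom S Q \<phi>"
  note hom = ring_hom_closed[OF assms(3)] ring_hom_add[OF assms(3)]
    ring_hom_mult[OF assms(3)] ring_hom_one[OF assms(3)]
  have "cring ?U"
    by (intro cringI abelian_groupI comm_monoidI bexI[where x = "\<ominus>\<^bsub>Q\<^esub> _"])
      (auto simp: Q.m_ac Q.a_ac Q.r_distr Q.r_neg)
  then have "algebra S ?U"
    by (intro algebraI assms(1)) (auto simp: hom Q.m_assoc Q.l_distr Q.r_distr)
  then show ?thesis
    by (auto simp: algebras_def)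
qed

text \<open>
  \<open>U\<close> plays the role of the polynomial algebra \<open>T[x\<^sub>j | j \<in> J]\<close> and \<open>x\<close> that of its generic point,
  which specialises to every point \<open>a\<close> of \<open>T\<^sup>J\<close> by \<open>ev a\<close>. Only points with values in \<open>T\<close> itself
  are needed, so polynomial \<^emph>\<open>functions\<close> \<open>T\<^sup>J \<rightarrow> T\<close> suffice: the subring of all functions
  generated by the constants and the coordinates, in which the ring laws hold pointwise. It is
  moved into the universe along an injection. The last property is the point of the construction:
  like a polynomial, a polynomial function involves only finitely many coordinates.
\<close>
lemma generic_point:
  fixes T :: "('u, 'u) module" and S :: "('u, 'z) ring_scheme" and J :: "'u set"
  assumes inf: "infinite (UNIV :: 'u set)" and T: "T \<in> algebras S"
  obtains U c x ev where "U \<in> algebras S" and "c \<in> algebra_hom S T U"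
    and "x \<in> J \<rightarrow>\<^sub>E carrier U"
    and "\<And>a. a \<in> J \<rightarrow>\<^sub>E carrier T \<Longrightarrow> ev a \<in> algebra_hom S U T"
    and "\<And>a t. a \<in> J \<rightarrow>\<^sub>E carrier T \<Longrightarrow> t \<in> carrier T \<Longrightarrow> ev a (c t) = t"
    and "\<And>a j. a \<in> J \<rightarrow>\<^sub>E carrier T \<Longrightarrow> j \<in> J \<Longrightarrow> ev a (x j) = a j"
    and "\<And>u. u \<in> carrier U \<Longrightarrow> \<exists>F. finite F \<and> F \<subseteq> J \<and>
      (\<forall>a\<in>J \<rightarrow>\<^sub>E carrier T. \<forall>b\<in>J \<rightarrow>\<^sub>E carrier T. (\<forall>j\<in>F. a j = b j) \<longrightarrow> ev a u = ev b u)"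
proof -
  have "algebra S T"
    using T by (simp add: algebras_def)
  interpret T: algebra S T by fact
  define D where "D = J \<rightarrow>\<^sub>E carrier T"
  define P where "P = product_algebra D T"
  interpret P: cring P
    unfolding P_def by (rule cring_product_algebra) (rule T.M_cring)
  define const where "const t = (\<lambda>a\<in>D. t)" for t :: 'u
  define coord where "coord j = (\<lambda>a\<in>D. a j)" for j :: 'u
  define H where "H = const ` carrier T \<union> coord ` J"
  have H: "H \<subseteq> carrier P"
    by (auto simp: H_def P_def product_algebra_def const_def coord_def D_def PiE_iff extensional_def
        split: if_splits)
  have "|const ` carrier T| \<le>o |UNIV :: 'u set|" "|coord ` J| \<le>o |UNIV :: 'u set|"
    by (meson card_of_image card_of_mono1 ordLeq_transitive subset_UNIV)+
  then have "|H| \<le>o |UNIV :: 'u set|"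
    unfolding H_def by (intro card_of_Un_ordLeq_infinite inf)
  then obtain \<iota> :: "_ \<Rightarrow> 'u" where inj: "inj_on \<iota> (generate_ring P H)"
    using ex_inj_on_generate_ring[OF inf] by blast
  define K where "K = P\<lparr>carrier := generate_ring P H\<rparr>"
  have K_simps: "carrier K = generate_ring P H"
    "monoid.mult K = monoid.mult P" "one K = one P" "ring.add K = ring.add P" "ring.zero K = ring.zero P"
    by (simp_all add: K_def)
  have "ring K"
    unfolding K_def by (rule P.generate_ring_is_ring[OF H])
  have gen: "generate_ring P H \<subseteq> carrier P"
    by (rule P.generate_ring_incl[OF H])
  interpret K: cring K
    by (intro cring.intro comm_monoid.intro comm_monoid_axioms.intro \<open>ring K\<close> ring.is_monoid)
      (use gen in \<open>auto simp: K_simps P.m_comm subset_iff\<close>)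
  define Q where "Q = image_ring \<iota> K"
  have inj': "inj_on \<iota> (carrier K)"
    using inj by (simp add: K_simps)
  \<comment> \<open>\<open>K\<close> is the ring of polynomial functions, \<open>Q\<close> its copy inside the universe.\<close>
  have iso: "\<iota> \<in> ring_iso K Q"
    unfolding Q_def by (rule inj_imp_image_ring_iso[OF inj'])
  have "cring Q"
    using K.ring_iso_imp_img_cring[OF iso] by (simp add: Q_def image_ring_def image_group_def monoid.defs)
  have inv_iso: "inv_into (carrier K) \<iota> \<in> ring_hom Q K"
    using ring_iso_set_sym[OF \<open>ring K\<close> iso] by (simp add: ring_iso_def)
  have const_hom: "const \<in> ring_hom T K"
    by (rule ring_hom_memI)
      (auto simp: K_simps const_def P_def product_algebra_def H_def fun_eq_iff intro: generate_ring.incl)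
  have "\<iota> \<in> ring_hom K Q"
    using iso by (simp add: ring_iso_def)
  then have const_hom': "\<iota> \<circ> const \<in> ring_hom T Q"
    by (rule ring_hom_trans[OF const_hom])
  define U where "U = algebra_of_hom S Q ((\<iota> \<circ> const) \<circ> structure_map S T)"
  define c where "c = restrict (\<iota> \<circ> const) (carrier T)"
  define x where "x = (\<lambda>j\<in>J. \<iota> (coord j))"
  define ev where "ev a = (\<lambda>u\<in>carrier U. inv_into (carrier K) \<iota> u a)" for a
  have carrier_U: "carrier U = \<iota> ` carrier K"
    using iso by (simp add: U_def ring_iso_def bij_betw_def)
  have ev_\<iota>: "ev a (\<iota> k) = k a" if "k \<in> carrier K" for a k
    using that inj' by (simp add: ev_def carrier_U)
  have smap: "structure_map S T \<in> ring_hom S T"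
    by (rule ring_hom_structure_map) fact
  have const_K: "const t \<in> carrier K" if "t \<in> carrier T" for t
    using that by (auto simp: K_simps H_def intro: generate_ring.incl)
  have coord_K: "coord j \<in> carrier K" if "j \<in> J" for j
    using that by (auto simp: K_simps H_def intro: generate_ring.incl)
  show thesis
  proof
    show "U \<in> algebras S"
      unfolding U_def
      by (intro algebra_of_hom_in_algebras ring_hom_trans[OF smap const_hom'] T.R_cring \<open>cring Q\<close>)
    show "c \<in> algebra_hom S T U"
      unfolding algebra_hom_def
    proof (intro CollectI conjI ballI)
      show "c \<in> ring_hom T U"
        using const_hom' by (auto simp: U_def c_def ring_hom_def)
      show "c \<in> extensional (carrier T)"
        by (simp add: c_def)
      fix r t assume r: "r \<in> carrier S" and t: "t \<in> carrier T"
      have "c (r \<odot>\<^bsub>T\<^esub> t) = c (structure_map S T r \<otimes>\<^bsub>T\<^esub> t)"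
        using r t by (simp add: structure_map_def T.smult_assoc2)
      also have "\<dots> = (\<iota> \<circ> const) (structure_map S T r) \<otimes>\<^bsub>Q\<^esub> (\<iota> \<circ> const) t"
        using ring_hom_mult[OF const_hom', of "structure_map S T r" t] ring_hom_closed[OF smap r] t
        by (simp add: c_def)
      finally show "c (r \<odot>\<^bsub>T\<^esub> t) = r \<odot>\<^bsub>U\<^esub> c t"
        using r t ring_hom_closed[OF const_hom'] by (simp add: U_def c_def)
    qed
    show "x \<in> J \<rightarrow>\<^sub>E carrier U"
      by (auto simp: x_def carrier_U coord_K)
  next
    fix a assume "a \<in> J \<rightarrow>\<^sub>E carrier T"
    then have a: "a \<in> D"
      by (simp add: D_def)
    have eval_hom: "(\<lambda>k. k a) \<in> ring_hom K T"
      using gen a by (intro ring_hom_memI) (auto simp: K_simps P_def product_algebra_def PiE_iff)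
    have "ring Q"
      by (rule cring.axioms) fact
    have "(\<lambda>k. k a) \<circ> inv_into (carrier K) \<iota> \<in> ring_hom Q T"
      by (rule ring_hom_trans[OF inv_iso eval_hom])
    then have "ev a \<in> ring_hom Q T"
      by (rule ring.ring_hom_restrict[OF \<open>ring Q\<close>]) (simp add: ev_def U_def)
    then have hom: "ev a \<in> ring_hom U T"
      by (simp add: U_def ring_hom_def)
    show evc: "ev a (c t) = t" if "t \<in> carrier T" for t
      using that a by (simp add: c_def ev_\<iota> const_K) (simp add: const_def)
    show "ev a \<in> algebra_hom S U T"
      unfolding algebra_hom_def
    proof (intro CollectI conjI ballI)
      show "ev a \<in> extensional (carrier U)"
        by (simp add: ev_def)
      fix r u assume r: "r \<in> carrier S" and u: "u \<in> carrier U"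
      have r': "structure_map S T r \<in> carrier T"
        by (rule ring_hom_closed[OF smap r])
      have "r \<odot>\<^bsub>U\<^esub> u = c (structure_map S T r) \<otimes>\<^bsub>U\<^esub> u"
        using r u r' by (simp add: U_def c_def)
      then have "ev a (r \<odot>\<^bsub>U\<^esub> u) = structure_map S T r \<otimes>\<^bsub>T\<^esub> ev a u"
        using u r' evc[OF r'] ring_hom_mult[OF hom, of "c (structure_map S T r)" u] ring_hom_closed[OF const_hom' r']
        by (simp add: c_def carrier_U U_def)
      then show "ev a (r \<odot>\<^bsub>U\<^esub> u) = r \<odot>\<^bsub>T\<^esub> ev a u"
        using r u ring_hom_closed[OF hom u] by (simp add: structure_map_def T.smult_assoc2)
    qed (rule hom)
    show "ev a (x j) = a j" if "j \<in> J" for j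
      using that a by (simp add: x_def ev_\<iota> coord_K) (simp add: coord_def)
  next
    fix u assume "u \<in> carrier U"
    then obtain k where k: "k \<in> generate_ring P H" "u = \<iota> k"
      by (auto simp: carrier_U K_simps)
    \<comment> \<open>\<open>k\<close> is built from finitely many constants and coordinates; the indices of
      these coordinates form \<open>F\<close>.\<close>
    define determines where "determines F h \<longleftrightarrow>
      (\<forall>a\<in>D. \<forall>b\<in>D. (\<forall>j\<in>F. a j = b j) \<longrightarrow> h a = h b)" for F and h :: "('u \<Rightarrow> 'u) \<Rightarrow> 'u"
    have "\<exists>F. finite F \<and> F \<subseteq> J \<and> determines F k"
      using k(1)
    proof (induction rule: generate_ring.induct)
      case one
      have "determines {} \<one>\<^bsub>P\<^esub>"
        by (simp add: determines_def P_def product_algebra_def)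
      then show ?case
        by (intro exI[of _ "{}"]) simp
    next
      case (incl h)
      then consider t where "h = const t" | j where "j \<in> J" "h = coord j"
        by (auto simp: H_def)
      then show ?case
      proof cases
        case 1
        then show ?thesis
          by (intro exI[of _ "{}"]) (simp add: determines_def const_def)
      next
        case 2
        then show ?thesis
          by (intro exI[of _ "{j}"]) (simp add: determines_def coord_def)
      qed
    next
      case (a_inv h)
      then obtain F where F: "finite F" "F \<subseteq> J" "determines F h"
        by blast
      have "h \<in> carrier P"
        using a_inv gen by blast
      then have hT: "h a \<in> carrier T" if "a \<in> D" for a
        using that by (auto simp: P_def product_algebra_def)
      have minus: "\<ominus>\<^bsub>P\<^esub> h = (\<lambda>a\<in>D. \<ominus>\<^bsub>T\<^esub> h a)"
      proof (rule P.minus_equality)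
        show "(\<lambda>a\<in>D. \<ominus>\<^bsub>T\<^esub> h a) \<oplus>\<^bsub>P\<^esub> h = \<zero>\<^bsub>P\<^esub>"
          using hT by (auto simp: P_def product_algebra_def T.M.l_neg intro!: restrict_ext)
        show "(\<lambda>a\<in>D. \<ominus>\<^bsub>T\<^esub> h a) \<in> carrier P"
          using hT by (simp add: P_def product_algebra_def)
      qed fact
      have "determines F (\<ominus>\<^bsub>P\<^esub> h)"
        unfolding determines_def
      proof (intro ballI impI)
        fix a b assume "a \<in> D" "b \<in> D" "\<forall>j\<in>F. a j = b j"
        moreover from this F(3) have "h a = h b"
          unfolding determines_def by blast
        ultimately show "(\<ominus>\<^bsub>P\<^esub> h) a = (\<ominus>\<^bsub>P\<^esub> h) b"
          by (simp add: minus)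
      qed
      then show ?case
        using F(1,2) by blast
    next
      case (eng_add h1 h2)
      from eng_add.IH(1) obtain F1 where 1: "finite F1" "F1 \<subseteq> J" "determines F1 h1"
        by blast
      from eng_add.IH(2) obtain F2 where 2: "finite F2" "F2 \<subseteq> J" "determines F2 h2"
        by blast
      have "determines (F1 \<union> F2) (h1 \<oplus>\<^bsub>P\<^esub> h2)"
        unfolding determines_def
      proof (intro ballI impI)
        fix a b assume "a \<in> D" "b \<in> D" "\<forall>j\<in>F1 \<union> F2. a j = b j"
        moreover from this 1(3) 2(3) have "h1 a = h1 b" "h2 a = h2 b"
          unfolding determines_def by blast+
        ultimately show "(h1 \<oplus>\<^bsub>P\<^esub> h2) a = (h1 \<oplus>\<^bsub>P\<^esub> h2) b"
          by (simp add: P_def product_algebra_def)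
      qed
      with 1 2 show ?case
        by (intro exI[of _ "F1 \<union> F2"]) simp
    next
      case (eng_mult h1 h2)
      from eng_mult.IH(1) obtain F1 where 1: "finite F1" "F1 \<subseteq> J" "determines F1 h1"
        by blast
      from eng_mult.IH(2) obtain F2 where 2: "finite F2" "F2 \<subseteq> J" "determines F2 h2"
        by blast
      have "determines (F1 \<union> F2) (h1 \<otimes>\<^bsub>P\<^esub> h2)"
        unfolding determines_def
      proof (intro ballI impI)
        fix a b assume "a \<in> D" "b \<in> D" "\<forall>j\<in>F1 \<union> F2. a j = b j"
        moreover from this 1(3) 2(3) have "h1 a = h1 b" "h2 a = h2 b"
          unfolding determines_def by blast+
        ultimately show "(h1 \<otimes>\<^bsub>P\<^esub> h2) a = (h1 \<otimes>\<^bsub>P\<^esub> h2) b"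
          by (simp add: P_def product_algebra_def)
      qed
      with 1 2 show ?case
        by (intro exI[of _ "F1 \<union> F2"]) simp
    qed
    then show "\<exists>F. finite F \<and> F \<subseteq> J \<and>
      (\<forall>a\<in>J \<rightarrow>\<^sub>E carrier T. \<forall>b\<in>J \<rightarrow>\<^sub>E carrier T. (\<forall>j\<in>F. a j = b j) \<longrightarrow> ev a u = ev b u)"
      unfolding determines_def using k by (simp add: ev_\<iota> K_simps D_def)
  qed
qed

section \<open>The natural morphism on elementary tensors\<close>

text \<open>
  The sum in \<^const>\<open>natural_hom\<close>, for an arbitrary function \<open>g\<close> on the generators.
\<close>
definition additive_extension ::
    "('k, 'b) module \<Rightarrow> ('a \<Rightarrow> 'b) \<Rightarrow> ('a \<Rightarrow>\<^sub>0 int) \<Rightarrow> 'b" where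
  "additive_extension N g c =
    finsum N (\<lambda>p. [Poly_Mapping.lookup c p] \<cdot>\<^bsub>N\<^esub> g p) (Poly_Mapping.keys c)"

text \<open>
  Elements with different supports can be added only after their sums are taken over a common
  index set.
\<close>
lemma additive_extension_superset:
  assumes "abelian_group N" "finite A" "Poly_Mapping.keys c \<subseteq> A" "g \<in> A \<rightarrow> carrier N"
  shows "additive_extension N g c = finsum N (\<lambda>p. [Poly_Mapping.lookup c p] \<cdot>\<^bsub>N\<^esub> g p) A"
proof -
  interpret N: abelian_group N by fact
  show ?thesis
    unfolding additive_extension_def
    by (rule N.add.finprod_mono_neutral_cong_left)
      (use assms in \<open>auto simp: in_keys_iff add_pow_int_ge intro!: N.add.int_pow_closed\<close>)
qed

lemma additive_extension_frag_of:
  assumes "abelian_group N" "g p \<in> carrier N"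
  shows "additive_extension N g (frag_of p) = g p"
proof -
  interpret N: abelian_group N by fact
  show ?thesis
    using assms(2) by (simp add: additive_extension_def N.add.int_pow_1)
qed

lemma additive_extension_hom:
  assumes "abelian_group N" "g \<in> A \<rightarrow> carrier N"
  shows "additive_extension N g \<in> hom (free_Abelian_group A) (add_monoid N)"
proof -
  interpret N: abelian_group N by fact
  show ?thesis
  proof (rule homI)
    fix c assume "c \<in> carrier (free_Abelian_group A)"
    then have "Poly_Mapping.keys c \<subseteq> A"
      by simp
    then show "additive_extension N g c \<in> carrier (add_monoid N)"
      using assms(2) unfolding additive_extension_def
      by (auto intro!: N.finsum_closed N.add.int_pow_closed)
  next
    fix c d assume cd: "c \<in> carrier (free_Abelian_group A)" "d \<in> carrier (free_Abelian_group A)"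
    let ?B = "Poly_Mapping.keys c \<union> Poly_Mapping.keys d"
    have B: "finite ?B" "g \<in> ?B \<rightarrow> carrier N" "Poly_Mapping.keys (c + d) \<subseteq> ?B"
      using cd assms(2) Poly_Mapping.keys_add[of c d] by auto
    have "additive_extension N g (c + d)
        = finsum N (\<lambda>p. [Poly_Mapping.lookup c p] \<cdot>\<^bsub>N\<^esub> g p \<oplus>\<^bsub>N\<^esub> [Poly_Mapping.lookup d p] \<cdot>\<^bsub>N\<^esub> g p) ?B"
      unfolding additive_extension_superset[OF assms(1) B(1,3,2)]
      by (rule N.finsum_cong')
        (use B(2) in \<open>auto simp: lookup_add N.add.int_pow_mult Pi_iff intro!: N.add.int_pow_closed\<close>)
    also have "\<dots> = additive_extension N g c \<oplus>\<^bsub>N\<^esub> additive_extension N g d"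
      using B by (subst N.finsum_addf) (auto simp: additive_extension_superset[OF assms(1) B(1)]
          intro!: N.add.int_pow_closed)
    finally show "additive_extension N g (c \<otimes>\<^bsub>free_Abelian_group A\<^esub> d) =
        additive_extension N g c \<otimes>\<^bsub>add_monoid N\<^esub> additive_extension N g d"
      by simp
  qed
qed

lemma additive_extension_vanishes_on_sum_relation:
  assumes "abelian_group N" "g \<in> A \<rightarrow> carrier N" "x \<in> A" "y \<in> A" "z \<in> A"
    and "g x = g y \<oplus>\<^bsub>N\<^esub> g z"
  shows "additive_extension N g (frag_of x - frag_of y - frag_of z) = \<zero>\<^bsub>N\<^esub>"
proof -
  interpret N: abelian_group N by fact
  note hom = additive_extension_hom[OF assms(1,2)]
  let ?d = "frag_of x - frag_of y - frag_of z"
  have d: "?d \<in> carrier (free_Abelian_group A)"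
    using assms(3-5) by (auto dest!: subsetD[OF keys_diff])
  have g: "g x \<in> carrier N" "g y \<in> carrier N" "g z \<in> carrier N"
    using assms by auto
  have yz: "frag_of y + frag_of z \<in> carrier (free_Abelian_group A)"
    using assms(3-5) by (auto dest!: subsetD[OF Poly_Mapping.keys_add])
  have dc: "additive_extension N g ?d \<in> carrier N"
    using hom_in_carrier[OF hom d] by simp
  have "g x = additive_extension N g (?d + (frag_of y + frag_of z))"
    using assms g by (simp add: additive_extension_frag_of)
  also have "\<dots> = additive_extension N g ?d \<oplus>\<^bsub>N\<^esub> (g y \<oplus>\<^bsub>N\<^esub> g z)"
    using hom_mult[OF hom d yz] hom_mult[OF hom, of "frag_of y" "frag_of z"] assms g
    by (simp add: additive_extension_frag_of)
  finally show ?thesis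
    using assms(6) g dc by (simp add: N.add.r_cancel_one')
qed

lemma additive_extension_vanishes_on_difference:
  assumes "abelian_group N" "g \<in> A \<rightarrow> carrier N" "x \<in> A" "y \<in> A" and "g x = g y"
  shows "additive_extension N g (frag_of x - frag_of y) = \<zero>\<^bsub>N\<^esub>"
proof -
  interpret N: abelian_group N by fact
  note hom = additive_extension_hom[OF assms(1,2)]
  let ?d = "frag_of x - frag_of y"
  have d: "?d \<in> carrier (free_Abelian_group A)"
    using assms(3-4) by (auto dest!: subsetD[OF keys_diff])
  have g: "g x \<in> carrier N" "g y \<in> carrier N"
    using assms by auto
  have dc: "additive_extension N g ?d \<in> carrier N"
    using hom_in_carrier[OF hom d] by simp
  have "g x = additive_extension N g (?d + frag_of y)"
    using assms g by (simp add: additive_extension_frag_of)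
  also have "\<dots> = additive_extension N g ?d \<oplus>\<^bsub>N\<^esub> g y"
    using hom_mult[OF hom d, of "frag_of y"] assms g
    by (simp add: additive_extension_frag_of)
  finally show ?thesis
    using assms(5) g dc by (simp add: N.add.r_cancel_one')
qed

lemma self_algebra_simps [simp]:
  "carrier (self_algebra S) = carrier S"
  "monoid.mult (self_algebra S) = monoid.mult S"
  "one (self_algebra S) = one S"
  "ring.zero (self_algebra S) = ring.zero S"
  "ring.add (self_algebra S) = ring.add S"
  "a \<odot>\<^bsub>self_algebra S\<^esub> x = (if a \<in> carrier S \<and> x \<in> carrier S then a \<otimes>\<^bsub>S\<^esub> x else undefined)"
  by (simp_all add: self_algebra_def)

lemma self_algebra_in_algebras:
  assumes "cring R"
  shows "self_algebra R \<in> algebras R"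
proof -
  interpret R: cring R by fact
  have "cring (self_algebra R)"
    by (intro cringI abelian_groupI comm_monoidI bexI[where x = "\<ominus>\<^bsub>R\<^esub> _"])
      (auto simp: R.m_ac R.a_ac R.r_distr R.r_neg)
  then have "algebra R (self_algebra R)"
    by (intro algebraI assms) (auto simp: R.m_assoc R.l_distr R.r_distr)
  then show ?thesis
    by (auto simp: algebras_def)
qed

lemma structure_map_in_algebra_hom:
  assumes "T \<in> algebras R"
  shows "structure_map R T \<in> algebra_hom R (self_algebra R) T"
proof -
  interpret algebra R T
    using assms by (simp add: algebras_def)
  have "structure_map R T \<in> ring_hom R T"
    by (rule ring_hom_structure_map) (rule algebra_axioms)
  then have "structure_map R T \<in> ring_hom (self_algebra R) T"
    by (simp add: ring_hom_def)
  then show ?thesis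
    by (auto simp: algebra_hom_def structure_map_def smult_assoc1)
qed

text \<open>
  The value of \<^const>\<open>natural_hom\<close> is a \<^const>\<open>the_elem\<close>, which is meaningful because the additive
  extension of \<open>(x, s) \<mapsto> s \<cdot> x\<close> kills the three kinds of bilinearity relations, hence the subgroup
  that they generate, and so is constant on the coset of \<open>m \<otimes> t\<close>.
\<close>
lemma natural_hom_elementary_tensor:
  fixes R :: "('u, 'z) ring_scheme" and M :: "('u, 'u, 'm) mod_functor"
  assumes R: "cring R" and M: "module_functor R scalar_functor M" and T: "T \<in> algebras R"
    and m: "m \<in> carrier (global_sections R M)" and t: "t \<in> carrier T"
  defines "X \<equiv> tensor_kernel R (global_sections R M) T
      #>\<^bsub>free_tensor (global_sections R M) T\<^esub> frag_of (m, t)"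
  shows "X \<in> carrier (base_change R (global_sections R M) T)"
    and "natural_hom R M T X
      = t \<odot>\<^bsub>fobj M T\<^esub> fmap M (self_algebra R) T (structure_map R T) m"
proof -
  define E where "E = global_sections R M"
  define A where "A = carrier E \<times> carrier T"
  define N where "N = fobj M T"
  define r where "r = fmap M (self_algebra R) T (structure_map R T)"
  define g where "g = (\<lambda>p. snd p \<odot>\<^bsub>N\<^esub> r (fst p))"
  let ?G = "free_Abelian_group A"
  let ?K = "tensor_kernel R E T"
  interpret M: module_functor R scalar_functor M by fact
  interpret T: algebra R T
    using T by (simp add: algebras_def)
  note T_comm = comm_monoid.m_comm[OF cring.axioms(2)[OF T.M_cring]]
  note self = self_algebra_in_algebras[OF R]
  note smap = structure_map_in_algebra_hom[OF T]
  interpret N: Module.module "self_algebra T" N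
    using M.fobj_module[OF T] by (simp add: N_def scalar_functor_def)
  interpret E: Module.module "self_algebra (self_algebra R)" E
    using M.fobj_module[OF self] by (simp add: E_def global_sections_def scalar_functor_def)
  have r_closed: "r x \<in> carrier N" if "x \<in> carrier E" for x
    using M.fmap_closed[OF self T smap] that by (simp add: r_def E_def N_def global_sections_def)
  have r_add: "r (x \<oplus>\<^bsub>E\<^esub> y) = r x \<oplus>\<^bsub>N\<^esub> r y" if "x \<in> carrier E" "y \<in> carrier E" for x y
    using M.fmap_add[OF self T smap] that by (simp add: r_def E_def N_def global_sections_def)
  have r_smult: "r (a \<odot>\<^bsub>E\<^esub> x) = structure_map R T a \<odot>\<^bsub>N\<^esub> r x"
    if "a \<in> carrier R" "x \<in> carrier E" for a x
    using M.fmap_smult[OF self T smap] that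
    by (simp add: r_def E_def N_def global_sections_def scalar_functor_def)
  have smult_closed: "s \<odot>\<^bsub>N\<^esub> x \<in> carrier N" if "s \<in> carrier T" "x \<in> carrier N" for s x
    using N.smult_closed that by simp
  have E_smult_closed: "s \<odot>\<^bsub>E\<^esub> x \<in> carrier E" if "s \<in> carrier R" "x \<in> carrier E" for s x
    using E.smult_closed that by simp
  have g: "g \<in> A \<rightarrow> carrier N"
    by (auto simp: g_def A_def r_closed smult_closed)
  have N: "abelian_group N" ..
  interpret G: group ?G by simp
  interpret group_hom ?G "add_monoid N" "additive_extension N g"
    by (intro group_hom.intro group_hom_axioms.intro additive_extension_hom[OF N g] G.group_axioms
        N.a_group)
  have rel: "c \<in> kernel ?G (add_monoid N) (additive_extension N g)"
    if "c \<in> tensor_relations R E T" for c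
  proof -
    have "c \<in> carrier ?G"
      using that by (auto simp: tensor_relations_def A_def E_smult_closed dest!: subsetD[OF keys_diff])
    moreover have "additive_extension N g c = \<zero>\<^bsub>N\<^esub>"
      using that unfolding tensor_relations_def
    proof (elim UnE CollectE exE conjE)
      fix x y s
      assume *: "c = frag_of (x \<oplus>\<^bsub>E\<^esub> y, s) - frag_of (x, s) - frag_of (y, s)"
        "x \<in> carrier E" "y \<in> carrier E" "s \<in> carrier T"
      then show ?thesis
        unfolding *(1) using N.smult_r_distr[of s "r x" "r y"]
        by (intro additive_extension_vanishes_on_sum_relation[OF N g]) (auto simp: A_def g_def r_add r_closed)
    next
      fix x s t
      assume *: "c = frag_of (x, s \<oplus>\<^bsub>T\<^esub> t) - frag_of (x, s) - frag_of (x, t)"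
        "x \<in> carrier E" "s \<in> carrier T" "t \<in> carrier T"
      then show ?thesis
        unfolding *(1) using N.smult_l_distr[of s t "r x"]
        by (intro additive_extension_vanishes_on_sum_relation[OF N g]) (auto simp: A_def g_def r_closed)
    next
      fix a x s
      assume *: "c = frag_of (a \<odot>\<^bsub>E\<^esub> x, s) - frag_of (x, a \<odot>\<^bsub>T\<^esub> s)"
        "a \<in> carrier R" "x \<in> carrier E" "s \<in> carrier T"
      have "a \<odot>\<^bsub>T\<^esub> s = s \<otimes>\<^bsub>T\<^esub> structure_map R T a"
        using * T_comm[of s "a \<odot>\<^bsub>T\<^esub> \<one>\<^bsub>T\<^esub>"] by (simp add: structure_map_def T.smult_assoc2)
      moreover have "structure_map R T a \<in> carrier T"
        using * by (simp add: structure_map_def)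
      ultimately show ?thesis
        unfolding *(1) using N.smult_assoc1[of s "structure_map R T a" "r x"] *(2-)
        by (intro additive_extension_vanishes_on_difference[OF N g])
          (auto simp: A_def g_def r_closed r_smult E_smult_closed)
    qed
    ultimately show ?thesis
      by (simp add: kernel_def)
  qed
  have kernel: "?K \<subseteq> kernel ?G (add_monoid N) (additive_extension N g)"
    unfolding tensor_kernel_def A_def[symmetric]
    by (rule G.generate_subgroup_incl[OF _ subgroup_kernel]) (use rel in blast)
  have mt: "(m, t) \<in> A"
    using m t by (simp add: A_def E_def)
  have X: "X = ?K #>\<^bsub>?G\<^esub> frag_of (m, t)"
    by (simp add: X_def E_def A_def)
  have zero: "0 \<in> ?K"
    unfolding tensor_kernel_def A_def[symmetric] using generate.one[of ?G] by simp
  have on_coset: "additive_extension N g c = g (m, t)" if "c \<in> X" for c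
  proof -
    from that obtain k where k: "k \<in> ?K" "c = k + frag_of (m, t)"
      by (auto simp: X r_coset_def)
    with kernel have "k \<in> carrier ?G" "additive_extension N g k = \<zero>\<^bsub>N\<^esub>"
      by (auto simp: kernel_def)
    then show ?thesis
      using hom_mult[of k "frag_of (m, t)"] mt g k(2)
      by (simp add: additive_extension_frag_of[OF N] Pi_iff)
  qed
  have "frag_of (m, t) \<in> X"
    using zero by (auto simp: X r_coset_def intro!: bexI[of _ 0])
  with on_coset have image: "additive_extension N g ` X = {g (m, t)}"
    by (auto intro!: image_eqI[where x = "frag_of (m, t)"])
  show X_in: "X \<in> carrier (base_change R (global_sections R M) T)"
    using mt unfolding X base_change_def Let_def FactGroup_def RCOSETS_def
    by (auto simp: A_def E_def)
  show "natural_hom R M T X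
      = t \<odot>\<^bsub>fobj M T\<^esub> fmap M (self_algebra R) T (structure_map R T) m"
    using image T X_in unfolding natural_hom_def additive_extension_def
    by (simp add: g_def r_def N_def)
qed

section \<open>Restriction of scalars and morphisms of functors\<close>

lemma restrict_scalars_simps [simp]:
  "carrier (restrict_scalars R f T) = carrier T"
  "monoid.mult (restrict_scalars R f T) = monoid.mult T"
  "one (restrict_scalars R f T) = one T"
  "ring.zero (restrict_scalars R f T) = ring.zero T"
  "ring.add (restrict_scalars R f T) = ring.add T"
  "r \<odot>\<^bsub>restrict_scalars R f T\<^esub> x =
    (if r \<in> carrier R \<and> x \<in> carrier T then f r \<odot>\<^bsub>T\<^esub> x else undefined)"
  by (simp_all add: restrict_scalars_def)

lemma restrict_scalars_in_algebras:
  assumes "cring R" "S \<in> algebras R" "T \<in> algebras S"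
  shows "restrict_scalars R (structure_map R S) T \<in> algebras R"
proof -
  interpret R: cring R by fact
  interpret S: algebra R S
    using assms(2) by (simp add: algebras_def)
  interpret T: algebra S T
    using assms(3) by (simp add: algebras_def)
  let ?f = "structure_map R S"
  have f: "?f \<in> ring_hom R S"
    by (rule ring_hom_structure_map) (rule S.algebra_axioms)
  note hom = ring_hom_closed[OF f] ring_hom_add[OF f] ring_hom_mult[OF f] ring_hom_one[OF f]
  have "cring (restrict_scalars R ?f T)"
    by (intro cringI abelian_groupI comm_monoidI bexI[where x = "\<ominus>\<^bsub>T\<^esub> _"])
      (auto simp: T.m_ac T.a_ac T.l_distr T.r_distr T.r_neg)
  then have "algebra R (restrict_scalars R ?f T)"
    by (intro algebraI assms(1))
      (auto simp: hom T.smult_l_distr T.smult_r_distr T.smult_assoc1 T.smult_assoc2)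
  then show ?thesis
    by (auto simp: algebras_def)
qed

lemma restrict_scalars_algebra_hom:
  assumes "S \<in> algebras R" "f \<in> algebra_hom S T U"
  shows "f \<in> algebra_hom R (restrict_scalars R (structure_map R S) T)
    (restrict_scalars R (structure_map R S) U)"
proof -
  interpret S: algebra R S
    using assms(1) by (simp add: algebras_def)
  have "structure_map R S r \<in> carrier S" if "r \<in> carrier R" for r
    using that by (simp add: structure_map_def)
  with assms(2) show ?thesis
    by (auto simp: algebra_hom_def ring_hom_def)
qed

lemma functor_homD:
  assumes h: "h \<in> functor_hom R A M N" and S: "S \<in> algebras R"
  shows "x \<in> carrier (fobj M S) \<Longrightarrow> h S x \<in> carrier (fobj N S)"
    and "\<lbrakk>x \<in> carrier (fobj M S); y \<in> carrier (fobj M S)\<rbrakk>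
      \<Longrightarrow> h S (x \<oplus>\<^bsub>fobj M S\<^esub> y) = h S x \<oplus>\<^bsub>fobj N S\<^esub> h S y"
    and "\<lbrakk>a \<in> carrier (fobj A S); x \<in> carrier (fobj M S)\<rbrakk>
      \<Longrightarrow> h S (a \<odot>\<^bsub>fobj M S\<^esub> x) = a \<odot>\<^bsub>fobj N S\<^esub> h S x"
    and "\<lbrakk>T \<in> algebras R; f \<in> algebra_hom R S T; x \<in> carrier (fobj M S)\<rbrakk>
      \<Longrightarrow> h T (fmap M S T f x) = fmap N S T f (h S x)"
proof -
  note h' = h[unfolded functor_hom_def mem_Collect_eq]
  show "x \<in> carrier (fobj M S) \<Longrightarrow> h S x \<in> carrier (fobj N S)"
    by (rule PiE_mem[OF PiE_mem[OF conjunct1[OF h'] S]])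
  show "\<lbrakk>x \<in> carrier (fobj M S); y \<in> carrier (fobj M S)\<rbrakk>
      \<Longrightarrow> h S (x \<oplus>\<^bsub>fobj M S\<^esub> y) = h S x \<oplus>\<^bsub>fobj N S\<^esub> h S y"
    by (rule h'[THEN conjunct2, THEN conjunct1, rule_format, OF S])
  show "\<lbrakk>a \<in> carrier (fobj A S); x \<in> carrier (fobj M S)\<rbrakk>
      \<Longrightarrow> h S (a \<odot>\<^bsub>fobj M S\<^esub> x) = a \<odot>\<^bsub>fobj N S\<^esub> h S x"
    by (rule h'[THEN conjunct2, THEN conjunct2, THEN conjunct1, rule_format, OF S])
  show "\<lbrakk>T \<in> algebras R; f \<in> algebra_hom R S T; x \<in> carrier (fobj M S)\<rbrakk>
      \<Longrightarrow> h T (fmap M S T f x) = fmap N S T f (h S x)"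
    by (rule h'[THEN conjunct2, THEN conjunct2, THEN conjunct2, rule_format, OF S])
qed

lemma functor_hom_eqI:
  assumes "h \<in> functor_hom R A M N" "k \<in> functor_hom R A M N"
    and "\<And>S x. S \<in> algebras R \<Longrightarrow> x \<in> carrier (fobj M S) \<Longrightarrow> h S x = k S x"
  shows "h = k"
proof (rule ext)
  fix S
  show "h S = k S"
  proof (cases "S \<in> algebras R")
    case True
    with assms show ?thesis
      by (intro PiE_ext[of _ "carrier (fobj M S)" "\<lambda>_. carrier (fobj N S)"])
        (auto simp: functor_hom_def PiE_mem)
  next
    case False
    have "h \<in> extensional (algebras R)" "k \<in> extensional (algebras R)"
      using assms(1,2) by (simp_all add: functor_hom_def PiE_def)
    then show ?thesis
      using extensional_arb[OF _ False] by metis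
  qed
qed

lemma restrict_functor_simps [simp]:
  "fobj (restrict_functor R S M) T = fobj M (restrict_scalars R (structure_map R S) T)"
  "fmap (restrict_functor R S M) T U = fmap M (restrict_scalars R (structure_map R S) T)
      (restrict_scalars R (structure_map R S) U)"
  by (simp_all add: restrict_functor_def)

lemma carrier_dual_functor [simp]:
  "carrier (fobj (dual_functor R M) S)
    = functor_hom S scalar_functor (restrict_functor R S M) scalar_functor"
  by (simp add: dual_functor_def)

lemma scalar_functor_simps [simp]:
  "fobj scalar_functor = self_algebra" "fmap scalar_functor S T f = f"
  by (simp_all add: scalar_functor_def)

section \<open>Functionals between the direct sum and the product\<close>

text \<open>
  The inclusions \<open>i\<close> of the sum and \<open>p\<close> into the product, over a fixed index set. From
  \<open>\<Prod>\<^sub>JR \<times> M \<rightarrow> M\<close> each \<open>m \<in> M(T)\<close> gives a morphism \<open>\<Prod>\<^sub>JR \<rightarrow> M\<close> over \<open>T\<close>, \<open>a \<mapsto> a \<cdot> m\<close>, along which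
  functionals on \<open>M\<close> become functionals on the product.
\<close>
locale functor_between_sum_and_product =
  fixes R :: "('u, 'z) ring_scheme" and M :: "('u, 'u, 'm) mod_functor"
    and J :: "'u set" and act i p
  assumes universe: "infinite (UNIV :: 'u set)"
    and R: "cring R"
    and M: "module_functor R scalar_functor M"
    and act: "module_functor R (product_functor J) (with_action M act)"
    and diagonal: "\<lbrakk>T \<in> algebras R; t \<in> carrier T; m \<in> carrier (fobj M T)\<rbrakk> \<Longrightarrow>
      act T (\<lambda>j\<in>J. t) m = t \<odot>\<^bsub>fobj M T\<^esub> m"
    and i: "i \<in> functor_hom R (product_functor J) (sum_module_functor J) (with_action M act)"
    and p: "p \<in> functor_hom R (product_functor J) (with_action M act) (product_module_functor J)"
    and p_inj: "injective_hom R (with_action M act) p"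
    and p_i: "\<lbrakk>T \<in> algebras R; a \<in> carrier (fobj (sum_module_functor J) T)\<rbrakk> \<Longrightarrow>
      p T (i T a) = a"
begin

lemma functor_simps [simp]:
  "carrier (fobj (with_action M act) T) = carrier (fobj M T)"
  "ring.add (fobj (with_action M act) T) = ring.add (fobj M T)"
  "a \<odot>\<^bsub>fobj (with_action M act) T\<^esub> m = act T a m"
  "fmap (with_action M act) = fmap M"
  "carrier (fobj (product_functor J) T) = J \<rightarrow>\<^sub>E carrier T"
  "fmap (product_functor J) T U f a = (\<lambda>j\<in>J. f (a j))"
  "carrier (fobj (product_module_functor J) T) = J \<rightarrow>\<^sub>E carrier T"
  "carrier (fobj (sum_module_functor J) T)
    = {a \<in> J \<rightarrow>\<^sub>E carrier T. finite {j \<in> J. a j \<noteq> \<zero>\<^bsub>T\<^esub>}}"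
  "ring.add (fobj (sum_module_functor J) T) = (\<lambda>a b. \<lambda>j\<in>J. a j \<oplus>\<^bsub>T\<^esub> b j)"
  "fmap (sum_module_functor J) T U f a = (\<lambda>j\<in>J. f (a j))"
  by (simp_all add: with_action_def product_functor_def product_module_functor_def
      sum_module_functor_def product_algebra_def self_algebra_def)

lemma product_smult [simp]:
  assumes "a \<in> J \<rightarrow>\<^sub>E carrier T" "b \<in> J \<rightarrow>\<^sub>E carrier T"
  shows "a \<odot>\<^bsub>fobj (product_module_functor J) T\<^esub> b = (\<lambda>j\<in>J. a j \<otimes>\<^bsub>T\<^esub> b j)"
    and "a \<odot>\<^bsub>fobj (sum_module_functor J) T\<^esub> b = (\<lambda>j\<in>J. a j \<otimes>\<^bsub>T\<^esub> b j)"
  using assms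
  by (simp_all add: product_module_functor_def sum_module_functor_def product_algebra_def
      self_algebra_def)

sublocale M: module_functor R scalar_functor M
  by (rule M)

sublocale act: module_functor R "product_functor J" "with_action M act"
  by (rule act)

lemma act_closed:
  assumes "T \<in> algebras R" "a \<in> J \<rightarrow>\<^sub>E carrier T" "m \<in> carrier (fobj M T)"
  shows "act T a m \<in> carrier (fobj M T)"
  using Module.module.smult_closed[OF act.fobj_module[OF assms(1)], of a m] assms(2,3) by simp

text \<open>
  Cutting \<open>m\<close> down to finitely many coordinates lands in the direct sum. Both sides have the same
  image in the product, where the action is componentwise, and \<open>p\<close> is injective.
\<close>
lemma act_indicator:
  assumes T: "T \<in> algebras R" and m: "m \<in> carrier (fobj M T)"
    and F: "finite F" "F \<subseteq> J"
  shows "act T (\<lambda>j\<in>J. if j \<in> F then \<one>\<^bsub>T\<^esub> else \<zero>\<^bsub>T\<^esub>) m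
    = i T (\<lambda>j\<in>J. if j \<in> F then p T m j else \<zero>\<^bsub>T\<^esub>)"
proof -
  interpret T: algebra R T
    using T by (simp add: algebras_def)
  let ?e = "\<lambda>j\<in>J. if j \<in> F then \<one>\<^bsub>T\<^esub> else \<zero>\<^bsub>T\<^esub>"
  let ?b = "\<lambda>j\<in>J. if j \<in> F then p T m j else \<zero>\<^bsub>T\<^esub>"
  have pm: "p T m \<in> J \<rightarrow>\<^sub>E carrier T"
    using functor_homD(1)[OF p T, of m] m by simp
  then have pm_closed: "p T m j \<in> carrier T" if "j \<in> J" for j
    using that by (auto simp: PiE_mem)
  have e: "?e \<in> J \<rightarrow>\<^sub>E carrier T"
    by auto
  have "{j \<in> J. ?b j \<noteq> \<zero>\<^bsub>T\<^esub>} \<subseteq> F"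
    by auto
  then have b: "?b \<in> carrier (fobj (sum_module_functor J) T)"
    using pm F by (auto simp: PiE_mem intro: finite_subset)
  have "p T (act T ?e m) = (\<lambda>j\<in>J. ?e j \<otimes>\<^bsub>T\<^esub> p T m j)"
    using functor_homD(3)[OF p T, of ?e m] e m pm by simp
  also have "\<dots> = ?b"
    using pm_closed by (auto simp: fun_eq_iff)
  also have "\<dots> = p T (i T ?b)"
    using p_i[OF T b] by simp
  finally have "p T (act T ?e m) = p T (i T ?b)" .
  moreover have "inj_on (p T) (carrier (fobj M T))"
    using p_inj T by (simp add: injective_hom_def)
  ultimately show ?thesis
    using act_closed[OF T e m] functor_homD(1)[OF i T b] by (simp add: inj_on_eq_iff)
qed

text \<open>
  This is the reason why the dual of a product is a direct sum. By naturality the value at any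
  \<open>a \<in> T\<^sup>J\<close> is the specialisation at \<open>a\<close> of one element, the value at the generic point, and
  that element involves only finitely many coordinates.
\<close>
lemma functional_depends_on_finitely_many_coordinates:
  assumes S: "S \<in> algebras R" and T: "T \<in> algebras S"
    and w: "w \<in> functor_hom S scalar_functor (restrict_functor R S M) scalar_functor"
  defines "T' \<equiv> restrict_scalars R (structure_map R S) T"
  assumes m: "m \<in> carrier (fobj M T')"
  obtains F where "finite F" "F \<subseteq> J"
    "\<And>a b. \<lbrakk>a \<in> J \<rightarrow>\<^sub>E carrier T; b \<in> J \<rightarrow>\<^sub>E carrier T; \<And>j. j \<in> F \<Longrightarrow> a j = b j\<rbrakk> \<Longrightarrow>
      w T (act T' a m) = w T (act T' b m)"
proof -
  obtain U c x ev where U: "U \<in> algebras S" and c: "c \<in> algebra_hom S T U"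
    and x: "x \<in> J \<rightarrow>\<^sub>E carrier U"
    and ev: "\<And>a. a \<in> J \<rightarrow>\<^sub>E carrier T \<Longrightarrow> ev a \<in> algebra_hom S U T"
    and ev_c: "\<And>a t. a \<in> J \<rightarrow>\<^sub>E carrier T \<Longrightarrow> t \<in> carrier T \<Longrightarrow> ev a (c t) = t"
    and ev_x: "\<And>a j. a \<in> J \<rightarrow>\<^sub>E carrier T \<Longrightarrow> j \<in> J \<Longrightarrow> ev a (x j) = a j"
    and dep: "\<And>u. u \<in> carrier U \<Longrightarrow> \<exists>F. finite F \<and> F \<subseteq> J \<and>
      (\<forall>a\<in>J \<rightarrow>\<^sub>E carrier T. \<forall>b\<in>J \<rightarrow>\<^sub>E carrier T. (\<forall>j\<in>F. a j = b j) \<longrightarrow> ev a u = ev b u)"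
    using generic_point[OF universe T, of J] by blast
  define U' where "U' = restrict_scalars R (structure_map R S) U"
  have T': "T' \<in> algebras R" and U': "U' \<in> algebras R"
    unfolding T'_def U'_def by (rule restrict_scalars_in_algebras[OF R S]; fact)+
  have c': "c \<in> algebra_hom R T' U'"
    unfolding T'_def U'_def by (rule restrict_scalars_algebra_hom[OF S c])
  have carriers [simp]: "carrier T' = carrier T" "carrier U' = carrier U"
    by (simp_all add: T'_def U'_def)
  define m\<^sub>U where "m\<^sub>U = fmap M T' U' c m"
  have m\<^sub>U: "m\<^sub>U \<in> carrier (fobj M U')"
    unfolding m\<^sub>U_def by (rule M.fmap_closed[OF T' U' c' m])
  have xm: "act U' x m\<^sub>U \<in> carrier (fobj M U')"
    using act_closed[OF U' _ m\<^sub>U] x by simp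
  have ev_w: "ev a (w U (act U' x m\<^sub>U)) = w T (act T' a m)" if a: "a \<in> J \<rightarrow>\<^sub>E carrier T" for a
  proof -
    have ev': "ev a \<in> algebra_hom R U' T'"
      unfolding T'_def U'_def by (rule restrict_scalars_algebra_hom[OF S ev[OF a]])
    have "compose (carrier T') (ev a) c = (\<lambda>t\<in>carrier T'. t)"
      using ev_c[OF a] by (auto simp: compose_def)
    then have "fmap M U' T' (ev a) m\<^sub>U = m"
      unfolding m\<^sub>U_def using M.fmap_comp[OF T' U' T' c' ev' m] M.fmap_id[OF T' m] by simp
    moreover have "(\<lambda>j\<in>J. ev a (x j)) = a"
      using ev_x[OF a] a by (auto simp: fun_eq_iff)
    ultimately have "fmap M U' T' (ev a) (act U' x m\<^sub>U) = act T' a m"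
      using act.fmap_smult[OF U' T' ev', of x m\<^sub>U] x m\<^sub>U by simp
    then show ?thesis
      using functor_homD(4)[OF w U T ev[OF a], of "act U' x m\<^sub>U"] xm
      by (simp add: T'_def U'_def)
  qed
  have "w U (act U' x m\<^sub>U) \<in> carrier U"
    using functor_homD(1)[OF w U, of "act U' x m\<^sub>U"] xm by (simp add: U'_def)
  from dep[OF this] obtain F where F: "finite F" "F \<subseteq> J"
    and det: "\<forall>a\<in>J \<rightarrow>\<^sub>E carrier T. \<forall>b\<in>J \<rightarrow>\<^sub>E carrier T. (\<forall>j\<in>F. a j = b j) \<longrightarrow>
      ev a (w U (act U' x m\<^sub>U)) = ev b (w U (act U' x m\<^sub>U))"
    by (elim exE conjE) (rule that)
  show thesis
  proof (rule that[OF F])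
    fix a b assume ab: "a \<in> J \<rightarrow>\<^sub>E carrier T" "b \<in> J \<rightarrow>\<^sub>E carrier T"
      and "\<And>j. j \<in> F \<Longrightarrow> a j = b j"
    then have "\<forall>j\<in>F. a j = b j"
      by blast
    from det[rule_format, OF ab this[rule_format]]
    show "w T (act T' a m) = w T (act T' b m)"
      by (simp only: ev_w[OF ab(1)] ev_w[OF ab(2)])
  qed
qed

text \<open>
  The direct sum is generated by the basis vectors, which are defined over \<open>R\<close>; so its image in
  \<open>M(T)\<close> consists of sums of elements \<open>t \<cdot> m\<close> with \<open>m\<close> coming from \<open>M(R)\<close>.
\<close>
lemma functionals_agree_on_sum:
  assumes S: "S \<in> algebras R" and T: "T \<in> algebras S"
    and w: "w \<in> functor_hom S scalar_functor (restrict_functor R S M) scalar_functor"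
    and v: "v \<in> functor_hom S scalar_functor (restrict_functor R S M) scalar_functor"
  defines "T' \<equiv> restrict_scalars R (structure_map R S) T"
  assumes eq: "\<And>m t. \<lbrakk>m \<in> carrier (global_sections R M); t \<in> carrier T\<rbrakk> \<Longrightarrow>
      w T (t \<odot>\<^bsub>fobj M T'\<^esub> fmap M (self_algebra R) T' (structure_map R T') m)
      = v T (t \<odot>\<^bsub>fobj M T'\<^esub> fmap M (self_algebra R) T' (structure_map R T') m)"
    and b: "b \<in> carrier (fobj (sum_module_functor J) T')"
  shows "w T (i T' b) = v T (i T' b)"
proof -
  have T': "T' \<in> algebras R"
    unfolding T'_def by (rule restrict_scalars_in_algebras[OF R S T])
  interpret T': algebra R T'
    using T' by (simp add: algebras_def)
  interpret R: cring R by (rule R)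
  note self = self_algebra_in_algebras[OF R]
  note smap = structure_map_in_algebra_hom[OF T']
  have carrier_T: "carrier T = carrier T'" and add_T: "ring.add T = ring.add T'"
    by (simp_all add: T'_def)
  define \<delta> where "\<delta> Q j = (\<lambda>k\<in>J. if k = j then \<one>\<^bsub>Q\<^esub> else \<zero>\<^bsub>Q\<^esub>)" for Q :: "('u, 'u) module" and j
  have fin: "finite {k \<in> J. (if k = j then s else z) \<noteq> z}" for j and s z :: 'u
    by (rule finite_subset[of _ "{j}"]) auto
  have coord: "w T (i T' (\<lambda>k\<in>J. if k = j then t else \<zero>\<^bsub>T'\<^esub>))
      = v T (i T' (\<lambda>k\<in>J. if k = j then t else \<zero>\<^bsub>T'\<^esub>))" if j: "j \<in> J" and t: "t \<in> carrier T'" for j t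
  proof -
    have \<delta>R: "\<delta> (self_algebra R) j \<in> carrier (fobj (sum_module_functor J) (self_algebra R))"
      using fin by (auto simp: \<delta>_def cong: conj_cong)
    have \<delta>T: "\<delta> T' j \<in> carrier (fobj (sum_module_functor J) T')"
      using fin by (auto simp: \<delta>_def cong: conj_cong)
    have m: "i (self_algebra R) (\<delta> (self_algebra R) j) \<in> carrier (global_sections R M)"
      using functor_homD(1)[OF i self \<delta>R] by (simp add: global_sections_def)
    \<comment> \<open>\<open>e\<^sub>j\<close> over \<open>T\<close> is the image of \<open>e\<^sub>j\<close> over \<open>R\<close>, and \<open>t \<cdot> e\<^sub>j\<close> is also the
      product of \<open>e\<^sub>j\<close> with the constant family \<open>t\<close>, and \<open>i\<close> respects such products.\<close>
    have "structure_map R T' \<zero>\<^bsub>R\<^esub> = \<zero>\<^bsub>T'\<^esub>" "structure_map R T' \<one>\<^bsub>R\<^esub> = \<one>\<^bsub>T'\<^esub>"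
      by (simp_all add: structure_map_def)
    then have "(\<lambda>k\<in>J. structure_map R T' (\<delta> (self_algebra R) j k)) = \<delta> T' j"
      by (auto simp: \<delta>_def fun_eq_iff)
    then have map: "fmap M (self_algebra R) T' (structure_map R T') (i (self_algebra R) (\<delta> (self_algebra R) j))
        = i T' (\<delta> T' j)"
      using functor_homD(4)[OF i self T' smap \<delta>R] by simp
    have ct: "(\<lambda>k\<in>J. t) \<in> J \<rightarrow>\<^sub>E carrier T'"
      using t by auto
    have "(\<lambda>k\<in>J. if k = j then t else \<zero>\<^bsub>T'\<^esub>) = (\<lambda>k\<in>J. t) \<odot>\<^bsub>fobj (sum_module_functor J) T'\<^esub> \<delta> T' j"
      using \<delta>T t ct by (auto simp: \<delta>_def fun_eq_iff)
    then have "i T' (\<lambda>k\<in>J. if k = j then t else \<zero>\<^bsub>T'\<^esub>) = act T' (\<lambda>k\<in>J. t) (i T' (\<delta> T' j))"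
      using functor_homD(3)[OF i T' _ \<delta>T, of "\<lambda>k\<in>J. t"] ct by simp
    also have "\<dots> = t \<odot>\<^bsub>fobj M T'\<^esub> i T' (\<delta> T' j)"
      using diagonal[OF T' t] functor_homD(1)[OF i T' \<delta>T] by simp
    finally show ?thesis
      using eq[OF m, of t] t by (simp add: map carrier_T)
  qed
  have add: "u T (i T' (\<lambda>j\<in>J. a j \<oplus>\<^bsub>T'\<^esub> a' j)) = u T (i T' a) \<oplus>\<^bsub>T\<^esub> u T (i T' a')"
    if "u \<in> functor_hom S scalar_functor (restrict_functor R S M) scalar_functor"
      "a \<in> carrier (fobj (sum_module_functor J) T')" "a' \<in> carrier (fobj (sum_module_functor J) T')"
    for u a a'
    using functor_homD(2)[OF i T' that(2,3)] functor_homD(1)[OF i T' that(2)]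
      functor_homD(1)[OF i T' that(3)]
      functor_homD(2)[OF that(1) T, of "i T' a" "i T' a'"]
    by (simp add: T'_def)
  have closed: "u T (i T' a) \<in> carrier T'"
    if "u \<in> functor_hom S scalar_functor (restrict_functor R S M) scalar_functor"
      "a \<in> carrier (fobj (sum_module_functor J) T')" for u a
    using functor_homD(1)[OF i T' that(2)] functor_homD(1)[OF that(1) T, of "i T' a"]
    by (simp add: T'_def)
  have zero: "u T (i T' (\<lambda>j\<in>J. \<zero>\<^bsub>T'\<^esub>)) = \<zero>\<^bsub>T'\<^esub>"
    if u: "u \<in> functor_hom S scalar_functor (restrict_functor R S M) scalar_functor" for u
  proof -
    have z: "(\<lambda>j\<in>J. \<zero>\<^bsub>T'\<^esub>) \<in> carrier (fobj (sum_module_functor J) T')"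
      by (auto cong: conj_cong)
    have "u T (i T' (\<lambda>j\<in>J. \<zero>\<^bsub>T'\<^esub>)) = u T (i T' (\<lambda>j\<in>J. \<zero>\<^bsub>T'\<^esub>)) \<oplus>\<^bsub>T'\<^esub> u T (i T' (\<lambda>j\<in>J. \<zero>\<^bsub>T'\<^esub>))"
      using add[OF u z z] add_T by (simp cong: restrict_cong)
    then show ?thesis
      using closed[OF u z] by (metis T'.M.add.r_cancel_one')
  qed
  have "\<forall>b\<in>carrier (fobj (sum_module_functor J) T'). {j \<in> J. b j \<noteq> \<zero>\<^bsub>T'\<^esub>} \<subseteq> F \<longrightarrow>
      w T (i T' b) = v T (i T' b)" if "finite F" for F
    using that
  proof (induction F)
    case empty
    show ?case
    proof (intro ballI impI)
      fix b assume b: "b \<in> carrier (fobj (sum_module_functor J) T')" "{j \<in> J. b j \<noteq> \<zero>\<^bsub>T'\<^esub>} \<subseteq> {}"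
      from b(1) have "b \<in> extensional J"
        by (simp add: PiE_iff)
      then have "b = (\<lambda>j\<in>J. \<zero>\<^bsub>T'\<^esub>)"
        by (rule extensionalityI) (use b(2) in auto)
      then show "w T (i T' b) = v T (i T' b)"
        by (simp add: zero[OF w] zero[OF v])
    qed
  next
    case (insert j F)
    show ?case
    proof (intro ballI impI)
      fix b assume b: "b \<in> carrier (fobj (sum_module_functor J) T')"
        "{k \<in> J. b k \<noteq> \<zero>\<^bsub>T'\<^esub>} \<subseteq> insert j F"
      show "w T (i T' b) = v T (i T' b)"
      proof (cases "j \<in> J")
        case False
        with b(2) have "{k \<in> J. b k \<noteq> \<zero>\<^bsub>T'\<^esub>} \<subseteq> F"
          by auto
        then show ?thesis
          by (rule insert.IH[rule_format, OF b(1)])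
      next
        case True
        define b\<^sub>0 where "b\<^sub>0 = (\<lambda>k\<in>J. if k = j then \<zero>\<^bsub>T'\<^esub> else b k)"
        define b\<^sub>1 where "b\<^sub>1 = (\<lambda>k\<in>J. if k = j then b j else \<zero>\<^bsub>T'\<^esub>)"
        have bc: "b k \<in> carrier T'" if "k \<in> J" for k
          using b(1) that by auto
        have supp: "{k \<in> J. b\<^sub>0 k \<noteq> \<zero>\<^bsub>T'\<^esub>} \<subseteq> F"
          using b(2) by (auto simp: b\<^sub>0_def)
        then have b0: "b\<^sub>0 \<in> carrier (fobj (sum_module_functor J) T')"
          using finite_subset[OF supp insert.hyps(1)] bc by (auto simp: b\<^sub>0_def)
        have b1: "b\<^sub>1 \<in> carrier (fobj (sum_module_functor J) T')"
          using fin[of j "b j" "\<zero>\<^bsub>T'\<^esub>"] bc True by (auto simp: b\<^sub>1_def cong: conj_cong)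
        have "b = (\<lambda>k\<in>J. b\<^sub>0 k \<oplus>\<^bsub>T'\<^esub> b\<^sub>1 k)"
        proof (rule extensionalityI)
          show "b \<in> extensional J"
            using b(1) by (simp add: PiE_iff)
          show "b k = (\<lambda>k\<in>J. b\<^sub>0 k \<oplus>\<^bsub>T'\<^esub> b\<^sub>1 k) k" if "k \<in> J" for k
            using that bc[OF that] bc[OF True] by (simp add: b\<^sub>0_def b\<^sub>1_def)
        qed simp
        moreover have "w T (i T' b\<^sub>0) = v T (i T' b\<^sub>0)"
          by (rule insert.IH[rule_format, OF b0 supp])
        moreover have "w T (i T' b\<^sub>1) = v T (i T' b\<^sub>1)"
          unfolding b\<^sub>1_def using True bc by (intro coord)
        ultimately show ?thesis
          using add[OF w b0 b1] add[OF v b0 b1] by simp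
      qed
    qed
  qed
  from this[rule_format, OF _ b subset_refl] b show ?thesis
    by simp
qed

text \<open>
  Let \<open>F\<close> and \<open>F'\<close> determine the two functionals along \<open>a \<mapsto> a \<cdot> m\<close>. The constant family \<open>1\<close>, for
  which \<open>1 \<cdot> m = m\<close>, agrees on \<open>F \<union> F'\<close> with the indicator of \<open>F \<union> F'\<close>, so \<open>m\<close> may be replaced by
  an element of the direct sum.
\<close>
lemma D_proquasi_coherent: "D_proquasi_coherent R M"
  unfolding D_proquasi_coherent_def injective_hom_def
proof (intro ballI inj_onI)
  let ?E = "global_sections R M"
  let ?h = "dual_hom R (quasi_coherent_functor R ?E) M (natural_hom R M)"
  fix S w v
  assume S: "S \<in> algebras R" and "w \<in> carrier (fobj (dual_functor R M) S)"
    "v \<in> carrier (fobj (dual_functor R M) S)" and eq: "?h S w = ?h S v"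
  then have w: "w \<in> functor_hom S scalar_functor (restrict_functor R S M) scalar_functor"
    and v: "v \<in> functor_hom S scalar_functor (restrict_functor R S M) scalar_functor"
    by simp_all
  show "w = v"
  proof (rule functor_hom_eqI[OF w v])
    fix T m assume T: "T \<in> algebras S" and "m \<in> carrier (fobj (restrict_functor R S M) T)"
    define T' where "T' = restrict_scalars R (structure_map R S) T"
    have T': "T' \<in> algebras R"
      unfolding T'_def by (rule restrict_scalars_in_algebras[OF R S T])
    interpret T': algebra R T'
      using T' by (simp add: algebras_def)
    have m: "m \<in> carrier (fobj M T')"
      using \<open>m \<in> _\<close> by (simp add: T'_def)
    have carrier_T: "carrier T = carrier T'"
      by (simp add: T'_def)
    have tensor: "w T (t \<odot>\<^bsub>fobj M T'\<^esub> fmap M (self_algebra R) T' (structure_map R T') x)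
        = v T (t \<odot>\<^bsub>fobj M T'\<^esub> fmap M (self_algebra R) T' (structure_map R T') x)"
      if x: "x \<in> carrier ?E" and t: "t \<in> carrier T" for x t
    proof -
      note elementary = natural_hom_elementary_tensor[OF R M T' x t[unfolded carrier_T]]
      have "w T (natural_hom R M T' X) = v T (natural_hom R M T' X)"
        if X: "X \<in> carrier (base_change R ?E T')" for X
        using fun_cong[OF fun_cong[OF eq], of T X] S T X w v
        by (simp add: dual_hom_def quasi_coherent_functor_def T'_def)
      from this[OF elementary(1)] show ?thesis
        by (simp add: elementary(2))
    qed
    obtain F where F: "finite F" "F \<subseteq> J" and w_F: "\<And>a b. \<lbrakk>a \<in> J \<rightarrow>\<^sub>E carrier T;
        b \<in> J \<rightarrow>\<^sub>E carrier T; \<And>j. j \<in> F \<Longrightarrow> a j = b j\<rbrakk> \<Longrightarrow> w T (act T' a m) = w T (act T' b m)"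
      using functional_depends_on_finitely_many_coordinates[OF S T w m[unfolded T'_def]]
      unfolding T'_def by blast
    obtain F' where F': "finite F'" "F' \<subseteq> J" and v_F': "\<And>a b. \<lbrakk>a \<in> J \<rightarrow>\<^sub>E carrier T;
        b \<in> J \<rightarrow>\<^sub>E carrier T; \<And>j. j \<in> F' \<Longrightarrow> a j = b j\<rbrakk> \<Longrightarrow> v T (act T' a m) = v T (act T' b m)"
      using functional_depends_on_finitely_many_coordinates[OF S T v m[unfolded T'_def]]
      unfolding T'_def by blast
    let ?e = "\<lambda>j\<in>J. if j \<in> F \<union> F' then \<one>\<^bsub>T'\<^esub> else \<zero>\<^bsub>T'\<^esub>"
    let ?b = "\<lambda>j\<in>J. if j \<in> F \<union> F' then p T' m j else \<zero>\<^bsub>T'\<^esub>"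
    have FF': "finite (F \<union> F')" "F \<union> F' \<subseteq> J"
      using F F' by auto
    interpret M': Module.module "self_algebra T'" "fobj M T'"
      using M.fobj_module[OF T'] by simp
    have one: "act T' (\<lambda>j\<in>J. \<one>\<^bsub>T'\<^esub>) m = m"
      using diagonal[OF T' _ m] M'.smult_one[OF m] by simp
    have e: "?e \<in> J \<rightarrow>\<^sub>E carrier T" "(\<lambda>j\<in>J. \<one>\<^bsub>T'\<^esub>) \<in> J \<rightarrow>\<^sub>E carrier T"
      by (auto simp: carrier_T)
    have "w T m = w T (act T' ?e m)"
      using w_F[OF e(2,1)] F one by (auto simp: subset_iff)
    moreover have "v T m = v T (act T' ?e m)"
      using v_F'[OF e(2,1)] F' one by (auto simp: subset_iff)
    moreover have "act T' ?e m = i T' ?b"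
      by (rule act_indicator[OF T' m FF'])
    moreover have "w T (i T' ?b) = v T (i T' ?b)"
    proof -
      have "{j \<in> J. ?b j \<noteq> \<zero>\<^bsub>T'\<^esub>} \<subseteq> F \<union> F'"
        by auto
      then have "?b \<in> carrier (fobj (sum_module_functor J) T')"
        using functor_homD(1)[OF p T', of m] m finite_subset[OF _ FF'(1)] by (auto simp: PiE_mem)
      then show ?thesis
        using functionals_agree_on_sum[OF S T w v tensor[unfolded T'_def]] unfolding T'_def by blast
    qed
    ultimately show "w T m = v T m"
      by simp
  qed
qed

end

theorem proposition5p11:
  fixes R :: "'u ring" and M :: "('u, 'u, 'm) mod_functor"
  assumes "infinite (UNIV :: 'u set)"
    and "cring R"
    and "family_F TYPE('n) R M"
  shows "D_proquasi_coherent R M"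
proof -
  from assms(3) have M: "module_functor R scalar_functor M"
    unfolding family_F_def by (rule conjunct1)
  from assms(3) obtain J :: "'u set" and act where
    act: "module_functor R (product_functor J) (with_action M act)"
    and diagonal: "\<forall>S\<in>algebras R. \<forall>s\<in>carrier S. \<forall>x\<in>carrier (fobj M S).
        act S (\<lambda>j\<in>J. s) x = s \<odot>\<^bsub>fobj M S\<^esub> x"
    and inclusions:
      "\<exists>i\<in>functor_hom R (product_functor J) (sum_module_functor J) (with_action M act).
       \<exists>p\<in>functor_hom R (product_functor J) (with_action M act) (product_module_functor J).
        injective_hom R (sum_module_functor J) i \<and>
        injective_hom R (with_action M act) p \<and>
        (\<forall>S\<in>algebras R. \<forall>a\<in>carrier (fobj (sum_module_functor J) S). p S (i S a) = a)"
    unfolding family_F_def by (elim exE conjE) (rule that)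
  from inclusions obtain i p where
    i: "i \<in> functor_hom R (product_functor J) (sum_module_functor J) (with_action M act)"
    and p: "p \<in> functor_hom R (product_functor J) (with_action M act) (product_module_functor J)"
    and p_inj: "injective_hom R (with_action M act) p"
    and p_i: "\<forall>S\<in>algebras R. \<forall>a\<in>carrier (fobj (sum_module_functor J) S). p S (i S a) = a"
    by (elim bexE conjE) (rule that)
  have "functor_between_sum_and_product R M J act i p"
  proof (rule functor_between_sum_and_product.intro)
    show "act T (\<lambda>j\<in>J. t) m = t \<odot>\<^bsub>fobj M T\<^esub> m"
      if "T \<in> algebras R" "t \<in> carrier T" "m \<in> carrier (fobj M T)" for T t m
      by (rule diagonal[rule_format, OF that])
    show "p T (i T a) = a"
      if "T \<in> algebras R" "a \<in> carrier (fobj (sum_module_functor J) T)" for T a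
      by (rule p_i[rule_format, OF that])
  qed (rule assms(1,2) M act i p p_inj)+
  then show ?thesis
    by (rule functor_between_sum_and_product.D_proquasi_coherent)
qed

end
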